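(* Fix integers $r\ge 2$, $\ell\ge 1$ and $C\ge 0$ (independent of $n$). For each $n\ge1$ let $K_{r\times(r-1)n}$ be the balanced complete $r$-partite graph with vertex partition $V_1\uplus\cdots\uplus V_r$, $|V_i|=(r-1)n$. Let $D_1,\dots,D_\ell$ (depending on $n$) be pairwise edge-disjoint subgraphs of $K_{r\times(r-1)n}$ with $\Delta(D_m)\le C$ for all $m$. Let $R$ be a uniformly random balanced perfect matching of $K_{r\times(r-1)n}$. Let $\mathbf X=(X_m)_{m=1}^\ell$ with $X_m=|E(R\cap D_m)|$, and let $\mathbf Y=(Y_m)_{m=1}^\ell$ with the $Y_m$ independent and $Y_m\sim\mathrm{Poisson}(|E(D_m)|/((r-1)^2n))$. Then \[\lim_{n\to\infty}d_{TV}(\mathbf X,\mathbf Y)=0.\]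
   Context: In $K_{r\times(r-1)n}$, two vertices are adjacent iff they lie in different parts $V_i$. A balanced perfect matching is a perfect matching in which the number of edges between $V_i$ and $V_j$ is the same for all pairs $i\ne j$ (hence equal to $n$). For random vectors $\mathbf X,\mathbf Y$ on $\mathbb N^\ell$, $d_{TV}(\mathbf X,\mathbf Y)=\sum_{\mathbf k\in\mathbb N^\ell}|\mathbb P(\mathbf X=\mathbf k)-\mathbb P(\mathbf Y=\mathbf k)|$. $\Delta(\cdot)$ is maximum degree. *)

theory Defs
  imports "HOL-Probability.Probability"
begin

record 'a ugraph =
  verts :: "'a set"
  edges :: "'a set set"

definition simple_graph :: "'a ugraph \<Rightarrow> bool" where
  "simple_graph G \<longleftrightarrow> finite (verts G) \<and> (\<forall>e\<in>edges G. e \<subseteq> verts G \<and> card e = 2)"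

definition subgraph_of :: "'a ugraph \<Rightarrow> 'a ugraph \<Rightarrow> bool" where
  "subgraph_of H G \<longleftrightarrow> simple_graph H \<and> verts H \<subseteq> verts G \<and> edges H \<subseteq> edges G"

definition vertex_degree :: "'a ugraph \<Rightarrow> 'a \<Rightarrow> nat" where
  "vertex_degree G v = card {e \<in> edges G. v \<in> e}"

(* On nat the supremum of the empty set is 0, so the graph without vertices has maximum degree 0. *)
definition max_degree :: "'a ugraph \<Rightarrow> nat" where
  "max_degree G = (SUP v\<in>verts G. vertex_degree G v)"

definition complete_multipartite :: "'i set \<Rightarrow> ('i \<Rightarrow> 'a set) \<Rightarrow> 'a ugraph" where
  "complete_multipartite I V =
     \<lparr>verts = (\<Union>i\<in>I. V i),
      edges = {{u, v} | u v. \<exists>i\<in>I. \<exists>j\<in>I. i \<noteq> j \<and> u \<in> V i \<and> v \<in> V j}\<rparr>"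

(* A perfect matching is identified with its set of edges. *)
definition perfect_matching :: "'a ugraph \<Rightarrow> 'a set set \<Rightarrow> bool" where
  "perfect_matching G M \<longleftrightarrow> M \<subseteq> edges G \<and> (\<forall>v\<in>verts G. \<exists>!e. e \<in> M \<and> v \<in> e)"

definition edges_between :: "'a set set \<Rightarrow> 'a set \<Rightarrow> 'a set \<Rightarrow> 'a set set" where
  "edges_between M A B = {e \<in> M. \<exists>u\<in>A. \<exists>v\<in>B. e = {u, v}}"

definition balanced_perfect_matchings :: "'i set \<Rightarrow> ('i \<Rightarrow> 'a set) \<Rightarrow> 'a set set set" where
  "balanced_perfect_matchings I V =
     {M. perfect_matching (complete_multipartite I V) M \<and>
         (\<exists>k. \<forall>i\<in>I. \<forall>j\<in>I. i \<noteq> j \<longrightarrow> card (edges_between M (V i) (V j)) = k)}"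

(* Vectors of N^l are functions on {1..l} extended by 0 elsewhere; this is the convention of
   Pi_pmf with default value 0. *)
definition nat_vectors :: "nat \<Rightarrow> (nat \<Rightarrow> nat) set" where
  "nat_vectors l = PiE_dflt {1..l} 0 (\<lambda>_. UNIV)"

definition matching_counts ::
    "nat \<Rightarrow> (nat \<Rightarrow> 'a ugraph) \<Rightarrow> 'a set set \<Rightarrow> nat \<Rightarrow> nat" where
  "matching_counts l D M = (\<lambda>m. if m \<in> {1..l} then card (M \<inter> edges (D m)) else 0)"

(* poisson_pmf is only specified for positive rate; the Poisson distribution with rate 0
   is the point mass at 0. *)
definition poisson0_pmf :: "real \<Rightarrow> nat pmf" where
  "poisson0_pmf rate = (if rate > 0 then poisson_pmf rate else return_pmf 0)"

lemma pmf_poisson0: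
  assumes "rate \<ge> 0"
  shows "pmf (poisson0_pmf rate) k = rate ^ k / fact k * exp (- rate)"
  using assms by (cases "rate = 0"; cases k) (auto simp: poisson0_pmf_def)

(* There is no factor 1/2, so the values lie in [0, 2]. *)
definition dist_TV :: "nat \<Rightarrow> (nat \<Rightarrow> nat) pmf \<Rightarrow> (nat \<Rightarrow> nat) pmf \<Rightarrow> real" where
  "dist_TV l p q = (\<Sum>\<^sub>\<infinity>k\<in>nat_vectors l. \<bar>pmf p k - pmf q k\<bar>)"

lemma dist_TV_summable:
  fixes p q :: "'a pmf"
  shows "(\<lambda>k. \<bar>pmf p k - pmf q k\<bar>) summable_on A"
proof -
  have *: "(\<lambda>k. pmf s k) summable_on A" for s :: "'a pmf"
    using pmf_abs_summable[of s A] abs_summable_equivalent[of "pmf s" A] by simp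
  show ?thesis
    by (rule summable_on_comparison_test[OF summable_on_add[OF *[of p] *[of q]]])
       (auto simp: abs_real_def)
qed

end

theory Submission
  imports Defs "HOL-Combinatorics.Transposition"
begin

text \<open>
  Fix an edge \<open>uv\<close> of \<open>D\<^sub>m\<close> between \<open>V\<^sub>i\<close> and \<open>V\<^sub>j\<close>. If \<open>u'v'\<close> is a uniformly random \<open>V\<^sub>i V\<^sub>j\<close>-edge of
  the random matching \<open>R\<close>, then applying the transpositions \<open>(u u')\<close> and \<open>(v v')\<close> to \<open>R\<close> yields a
  uniformly random balanced perfect matching conditioned on containing \<open>uv\<close>. Outside an event of
  probability \<open>O(1/n)\<close> the switch neither destroys an edge of any \<open>D\<close> nor creates one other than
  \<open>uv\<close>, so it changes the vector of counts exactly by the unit vector \<open>e\<^sub>m\<close>. Summing over the edges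
  of \<open>D\<^sub>m\<close> gives \<open>(k\<^sub>m + 1) P(X = k + e\<^sub>m) = \<lambda>\<^sub>m P(X = k) + O(1/n)\<close>, which the Poisson vector
  satisfies without error term. Hence \<open>P(X = k)\<close> is close to a constant multiple of \<open>P(Y = k)\<close>
  on every fixed box of vectors, and since the means are bounded, Markov's inequality shows that
  a large box carries almost all the mass of both laws, so the constant is close to \<open>1\<close>.
\<close>

section \<open>Balanced perfect matchings\<close>

locale equipartition =
  fixes I :: "'i set" and V :: "'i \<Rightarrow> 'a set" and n :: nat
  assumes finite_I: "finite I" and card_I: "card I \<ge> 2" and n_pos: "n \<ge> 1"
    and disj: "disjoint_family_on V I"
    and finite_part: "\<And>i. i \<in> I \<Longrightarrow> finite (V i)"
    and card_part: "\<And>i. i \<in> I \<Longrightarrow> card (V i) = (card I - 1) * n"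
begin

abbreviation \<M> :: "'a set set set" where
  "\<M> \<equiv> balanced_perfect_matchings I V"

definition s :: nat where
  "s = (card I - 1) * n"

lemma n_le_s: "n \<le> s"
proof -
  have "1 \<le> card I - 1" using card_I by linarith
  from mult_le_mono1[OF this, of n] show ?thesis by (simp add: s_def)
qed

lemma s_pos: "s > 0"
  using n_pos n_le_s by linarith

lemma card_part_s: "i \<in> I \<Longrightarrow> card (V i) = s"
  by (simp add: s_def card_part)

lemma same_part:
  assumes "i \<in> I" "j \<in> I" "x \<in> V i" "x \<in> V j"
  shows "i = j"
  using disj assms by (auto simp: disjoint_family_on_def)

lemma finite_verts: "finite (\<Union>i\<in>I. V i)"
  using finite_I finite_part by auto

lemma matching_edge:
  assumes "M \<in> \<M>" "e \<in> M"
  obtains i j x y where "i \<in> I" "j \<in> I" "i \<noteq> j" "x \<in> V i" "y \<in> V j" "e = {x, y}"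
proof -
  have "e \<in> edges (complete_multipartite I V)"
    using assms by (auto simp: balanced_perfect_matchings_def perfect_matching_def)
  thus ?thesis
    using that by (auto simp: complete_multipartite_def)
qed

lemma finite_matching: "M \<in> \<M> \<Longrightarrow> finite M"
  by (rule finite_subset[of _ "Pow (\<Union>i\<in>I. V i)"])
     (use finite_verts in \<open>auto elim!: matching_edge\<close>)

lemma finite_\<M>: "finite \<M>"
  by (rule finite_subset[of _ "Pow (Pow (\<Union>i\<in>I. V i))"])
     (use finite_verts in \<open>auto elim!: matching_edge\<close>)

lemma matching_ex1:
  assumes "M \<in> \<M>" "x \<in> V i" "i \<in> I"
  shows "\<exists>!e. e \<in> M \<and> x \<in> e"
  using assms
  by (auto simp: balanced_perfect_matchings_def perfect_matching_def complete_multipartite_def)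

lemma edge_unique:
  assumes M: "M \<in> \<M>" and "e \<in> M" "f \<in> M" "x \<in> e" "x \<in> f"
  shows "e = f"
proof -
  obtain i where "i \<in> I" "x \<in> V i"
    using M \<open>e \<in> M\<close> \<open>x \<in> e\<close> by (elim matching_edge) auto
  with matching_ex1[OF M] assms show ?thesis by blast
qed

lemma partner_unique:
  assumes "M \<in> \<M>" "{x, y} \<in> M" "{x, z} \<in> M"
  shows "y = z"
proof -
  have "{x, y} = {x, z}"
    using edge_unique[OF assms, of x] by simp
  thus ?thesis by (auto simp: doubleton_eq_iff)
qed

lemma matched:
  assumes M: "M \<in> \<M>" and x: "x \<in> V i" "i \<in> I"
  obtains y j where "j \<in> I" "j \<noteq> i" "y \<in> V j" "{x, y} \<in> M"
proof -
  obtain e where e: "e \<in> M" "x \<in> e"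
    using matching_ex1[OF assms] by blast
  obtain a b u v where ab: "a \<in> I" "b \<in> I" "a \<noteq> b" "u \<in> V a" "v \<in> V b" "e = {u, v}"
    using M e(1) by (rule matching_edge)
  show ?thesis
  proof (cases "x = u")
    case True
    with ab x same_part have "a = i" by blast
    with True ab e that[of b v] show ?thesis by auto
  next
    case False
    with ab e have "x = v" by auto
    with ab x same_part have "b = i" by blast
    with \<open>x = v\<close> ab e that[of a u] show ?thesis by (auto simp: insert_commute)
  qed
qed

text \<open>Each edge is oriented from \<open>V i\<close> to \<open>V j\<close>, so that it has a
  definite first endpoint, the one that the switch will exchange with \<open>u\<close>.\<close>

definition matched_pairs :: "'a set set \<Rightarrow> 'i \<Rightarrow> 'i \<Rightarrow> ('a \<times> 'a) set" where
  "matched_pairs M i j = {(x, y) \<in> V i \<times> V j. {x, y} \<in> M}"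

lemma finite_matched_pairs: "i \<in> I \<Longrightarrow> j \<in> I \<Longrightarrow> finite (matched_pairs M i j)"
  by (rule finite_subset[of _ "V i \<times> V j"]) (auto simp: matched_pairs_def finite_part)

lemma card_matched_pairs_eq_edges_between:
  assumes "i \<in> I" "j \<in> I" "i \<noteq> j"
  shows "card (matched_pairs M i j) = card (edges_between M (V i) (V j))"
proof (rule bij_betw_same_card[of "\<lambda>(x, y). {x, y}"])
  have "inj_on (\<lambda>(x, y). {x, y}) (matched_pairs M i j)"
    using assms same_part by (fastforce simp: inj_on_def matched_pairs_def doubleton_eq_iff)
  moreover have "(\<lambda>(x, y). {x, y}) ` matched_pairs M i j = edges_between M (V i) (V j)"
    by (auto simp: matched_pairs_def edges_between_def)
  ultimately show "bij_betw (\<lambda>(x, y). {x, y}) (matched_pairs M i j)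
      (edges_between M (V i) (V j))"
    by (simp add: bij_betw_def)
qed

text \<open>Balance only provides a common value \<open>k\<close>. Every vertex of
  \<open>V i\<close> has exactly one partner, and it lies in another part; sorting
  \<open>V i\<close> by the part of the partner gives
  \<open>(card I - 1) * k = (card I - 1) * n\<close>.\<close>

lemma card_matched_pairs:
  assumes M: "M \<in> \<M>" and ij: "i \<in> I" "j \<in> I" "i \<noteq> j"
  shows "card (matched_pairs M i j) = n"
proof -
  obtain k where k: "\<And>a b. a \<in> I \<Longrightarrow> b \<in> I \<Longrightarrow> a \<noteq> b \<Longrightarrow>
      card (edges_between M (V a) (V b)) = k"
    using M by (auto simp: balanced_perfect_matchings_def)
  hence card_k: "card (matched_pairs M a b) = k" if "a \<in> I" "b \<in> I" "a \<noteq> b" for a b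
    using card_matched_pairs_eq_edges_between that by simp
  define S where "S = (SIGMA a:I - {i}. matched_pairs M i a)"
  have "inj_on (\<lambda>(a, (x, y)). x) S"
  proof (rule inj_onI)
    fix p q assume pq: "p \<in> S" "q \<in> S" "(\<lambda>(a, (x, y)). x) p = (\<lambda>(a, (x, y)). x) q"
    obtain a x y b x' z where eqs: "p = (a, x, y)" "q = (b, x', z)"
      by (metis prod_cases3)
    with pq have *: "x' = x" "a \<in> I" "b \<in> I" "y \<in> V a" "z \<in> V b"
      "{x, y} \<in> M" "{x, z} \<in> M" by (auto simp: S_def matched_pairs_def)
    have "y = z" using partner_unique[OF M] * by blast
    with * same_part eqs show "p = q" by blast
  qed
  moreover have "(\<lambda>(a, (x, y)). x) ` S = V i"
  proof (intro equalityI subsetI)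
    fix x assume "x \<in> V i"
    then obtain y a where "a \<in> I" "a \<noteq> i" "y \<in> V a" "{x, y} \<in> M"
      using matched[OF M] ij by metis
    with \<open>x \<in> V i\<close> have "(a, (x, y)) \<in> S" by (auto simp: S_def matched_pairs_def)
    thus "x \<in> (\<lambda>(a, (x, y)). x) ` S" by force
  qed (auto simp: S_def matched_pairs_def)
  ultimately have "card S = card (V i)"
    by (metis card_image)
  moreover have "card S = (\<Sum>a\<in>I - {i}. card (matched_pairs M i a))"
    unfolding S_def using finite_I finite_matched_pairs ij by (subst card_SigmaI) auto
  moreover have "\<dots> = (\<Sum>a\<in>I - {i}. k)"
    using card_k ij by (intro sum.cong) auto
  ultimately have "(card I - 1) * k = (card I - 1) * n"
    using ij card_part by (simp add: card_Diff_singleton finite_I)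
  hence "k = n" using card_I by simp
  with card_k ij show ?thesis by simp
qed

text \<open>A permutation that maps every part onto itself is an automorphism of the multipartite
  graph and carries the edges between two parts to edges between the same parts.\<close>

lemma permuted_matching:
  assumes M: "M \<in> \<M>" and "bij \<sigma>" and parts: "\<And>i. i \<in> I \<Longrightarrow> \<sigma> ` V i = V i"
  shows "(`) \<sigma> ` M \<in> \<M>"
proof -
  have inj: "inj \<sigma>" using \<open>bij \<sigma>\<close> by (simp add: bij_is_inj)
  let ?M = "(`) \<sigma> ` M"
  have "?M \<subseteq> edges (complete_multipartite I V)"
  proof
    fix f assume "f \<in> ?M"
    then obtain e where e: "e \<in> M" "f = \<sigma> ` e" by blast
    obtain a b u v where "a \<in> I" "b \<in> I" "a \<noteq> b" "u \<in> V a" "v \<in> V b" "e = {u, v}"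
      using M e(1) by (rule matching_edge)
    with e parts have "a \<in> I" "b \<in> I" "a \<noteq> b" "\<sigma> u \<in> V a" "\<sigma> v \<in> V b" "f = {\<sigma> u, \<sigma> v}"
      by auto
    thus "f \<in> edges (complete_multipartite I V)"
      by (auto simp: complete_multipartite_def)
  qed
  moreover have "\<exists>!e. e \<in> ?M \<and> v \<in> e" if v: "i \<in> I" "v \<in> V i" for i v
  proof -
    have "v \<in> \<sigma> ` V i" using parts v by simp
    then obtain w where w: "w \<in> V i" "v = \<sigma> w" by blast
    obtain e where e: "e \<in> M" "w \<in> e"
      using matching_ex1[OF M w(1) v(1)] by blast
    show ?thesis
    proof (rule ex1I[of _ "\<sigma> ` e"])
      fix f assume "f \<in> ?M \<and> v \<in> f"
      then obtain e' where e': "e' \<in> M" "f = \<sigma> ` e'" by blast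
      with \<open>f \<in> ?M \<and> v \<in> f\<close> w inj have "w \<in> e'" by (simp add: inj_image_mem_iff)
      with e' show "f = \<sigma> ` e" using edge_unique[OF M e(1) e'(1) e(2)] by simp
    qed (use e w in auto)
  qed
  moreover have "card (edges_between ?M (V i) (V j)) = card (edges_between M (V i) (V j))"
    if ij: "i \<in> I" "j \<in> I" for i j
  proof -
    have "edges_between ?M (V i) (V j) = (`) \<sigma> ` edges_between M (V i) (V j)"
    proof (intro equalityI subsetI)
      fix f assume "f \<in> edges_between ?M (V i) (V j)"
      then obtain u v e where "u \<in> V i" "v \<in> V j" "f = {u, v}" "e \<in> M" "f = \<sigma> ` e"
        by (auto simp: edges_between_def)
      moreover from this obtain u' v' where "u' \<in> V i" "u = \<sigma> u'" "v' \<in> V j" "v = \<sigma> v'"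
        using parts[OF ij(1)] parts[OF ij(2)] by (metis imageE)
      ultimately have "\<sigma> ` e = \<sigma> ` {u', v'}" "u' \<in> V i" "v' \<in> V j" "e \<in> M" "f = \<sigma> ` e" by auto
      moreover from this have "e = {u', v'}" using inj by (simp only: inj_image_eq_iff)
      ultimately have "e \<in> edges_between M (V i) (V j)" "f = \<sigma> ` e"
        by (auto simp: edges_between_def)
      thus "f \<in> (`) \<sigma> ` edges_between M (V i) (V j)" by blast
    next
      fix f assume "f \<in> (`) \<sigma> ` edges_between M (V i) (V j)"
      then obtain u v where *: "u \<in> V i" "v \<in> V j" "{u, v} \<in> M" "f = \<sigma> ` {u, v}"
        by (auto simp: edges_between_def)
      hence "\<sigma> u \<in> V i" "\<sigma> v \<in> V j" using parts ij by auto
      moreover have "f \<in> ?M" using *(3,4) by blast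
      moreover have "f = {\<sigma> u, \<sigma> v}" using *(4) by simp
      ultimately show "f \<in> edges_between ?M (V i) (V j)"
        unfolding edges_between_def by blast
    qed
    thus ?thesis
      using inj by (simp add: card_image inj_on_def inj_image_eq_iff)
  qed
  ultimately show ?thesis
    using M by (auto simp: balanced_perfect_matchings_def perfect_matching_def
        complete_multipartite_def)
qed

text \<open>Ensures that \<open>pmf_of_set \<M>\<close> is the uniform law and that
  \<open>card \<M>\<close> can serve as a denominator.\<close>

lemma \<M>_nonempty: "\<M> \<noteq> {}"
proof -
  have "\<exists>h. bij_betw h ((I - {i}) \<times> {..<n}) (V i)" if "i \<in> I" for i
    using that finite_I card_part[OF that]
    by (intro finite_same_card_bij) (auto simp: finite_part card_cartesian_product)
  then obtain h where h: "\<And>i. i \<in> I \<Longrightarrow> bij_betw (h i) ((I - {i}) \<times> {..<n}) (V i)"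
    by metis
  have h_in: "h i (j, t) \<in> V i" if "i \<in> I" "j \<in> I" "i \<noteq> j" "t < n" for i j t
    using bij_betwE[OF h[OF that(1)]] that by auto
  have h_inj: "j = j' \<and> t = t'" if "h i (j, t) = h i (j', t')" "i \<in> I" "j \<in> I" "j' \<in> I"
    "i \<noteq> j" "i \<noteq> j'" "t < n" "t' < n" for i j j' t t'
    using bij_betw_imp_inj_on[OF h[OF that(2)]] that by (auto simp: inj_on_def)
  \<comment> \<open>label the vertices of \<open>V i\<close> by the pairs \<open>(j, t)\<close>, and match \<open>(j, t)\<close> in \<open>V i\<close>
      with \<open>(i, t)\<close> in \<open>V j\<close>\<close>
  define e where "e = (\<lambda>i j t. {h i (j, t), h j (i, t)})"
  define M where "M = {e i j t | i j t. i \<in> I \<and> j \<in> I \<and> i \<noteq> j \<and> t < n}"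
  have e_sym: "e i j t = e j i t" for i j t by (auto simp: e_def)
  \<comment> \<open>Uniqueness of the edge at a vertex: by \<open>e_sym\<close> the vertex may be
    taken as the first endpoint \<open>h a (b, t')\<close>; disjointness of the parts gives
    \<open>a = i\<close>, and injectivity of \<open>h i\<close> recovers the label.\<close>
  have e_eq: "f = e i j t" if f: "f \<in> M" "h i (j, t) \<in> f" and ij: "i \<in> I" "j \<in> I" "i \<noteq> j" "t < n"
    for f i j t
  proof -
    obtain a b t' where ab: "a \<in> I" "b \<in> I" "a \<noteq> b" "t' < n" "f = e a b t'"
      "h i (j, t) = h a (b, t')"
    proof -
      obtain a b t' where *: "a \<in> I" "b \<in> I" "a \<noteq> b" "t' < n" "f = e a b t'"
        using f(1) by (auto simp: M_def)
      show ?thesis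
      proof (cases "h i (j, t) = h a (b, t')")
        case False
        with * f(2) have "h i (j, t) = h b (a, t')" by (auto simp: e_def)
        with * e_sym[of a b t'] that[of b a t'] show ?thesis by auto
      qed (use * that in auto)
    qed
    have "i = a" using same_part[OF ij(1) ab(1) h_in[OF ij]] h_in[OF ab(1-4)] ab(6) by simp
    thus ?thesis using h_inj[of i j t b t'] ab ij by auto
  qed
  have "M \<subseteq> edges (complete_multipartite I V)"
    using h_in by (auto simp: M_def e_def complete_multipartite_def) metis
  moreover have "\<exists>!f. f \<in> M \<and> v \<in> f" if v: "i \<in> I" "v \<in> V i" for i v
  proof -
    have "v \<in> h i ` ((I - {i}) \<times> {..<n})" using h[OF v(1)] v(2) by (simp add: bij_betw_def)
    then obtain j t where jt: "j \<in> I" "i \<noteq> j" "t < n" "v = h i (j, t)" by auto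
    show ?thesis
    proof (rule ex1I[of _ "e i j t"])
      show "e i j t \<in> M \<and> v \<in> e i j t" using jt v by (auto simp: M_def e_def)
    qed (use e_eq jt v in auto)
  qed
  moreover have "card (edges_between M (V i) (V j)) = n" if ij: "i \<in> I" "j \<in> I" "i \<noteq> j" for i j
  proof -
    have "edges_between M (V i) (V j) = e i j ` {..<n}"
    proof (intro equalityI subsetI)
      fix f assume f: "f \<in> edges_between M (V i) (V j)"
      then obtain u v where uv: "u \<in> V i" "v \<in> V j" "f = {u, v}" "f \<in> M"
        by (auto simp: edges_between_def)
      have "u \<in> h i ` ((I - {i}) \<times> {..<n})" using h[OF ij(1)] uv(1) by (simp add: bij_betw_def)
      then obtain a t where a: "a \<in> I" "i \<noteq> a" "t < n" "u = h i (a, t)" by auto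
      hence fe: "f = e i a t" using e_eq[of f i a t] uv ij by auto
      have "v \<noteq> u" using same_part ij uv by blast
      hence "v = h a (i, t)" using fe uv a by (auto simp: e_def doubleton_eq_iff)
      hence "a = j" using same_part[OF a(1) ij(2), of v] h_in[of a i t] a uv ij by auto
      with a fe show "f \<in> e i j ` {..<n}" by auto
    next
      fix f assume "f \<in> e i j ` {..<n}"
      then obtain t where "t < n" "f = e i j t" by auto
      with ij h_in[of i j t] h_in[of j i t] show "f \<in> edges_between M (V i) (V j)"
        by (auto simp: edges_between_def M_def e_def)
    qed
    moreover have "inj_on (e i j) {..<n}"
    proof (rule inj_onI)
      fix t t' assume t: "t \<in> {..<n}" "t' \<in> {..<n}" "e i j t = e i j t'"
      have "h i (j, t) \<noteq> h j (i, t')"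
        using same_part[of i j] h_in[of i j t] h_in[of j i t'] t ij by force
      hence "h i (j, t) = h i (j, t')" using t by (auto simp: e_def doubleton_eq_iff)
      with h_inj ij t show "t = t'" by auto
    qed
    ultimately show ?thesis by (simp add: card_image)
  qed
  ultimately have "M \<in> \<M>"
    by (auto simp: balanced_perfect_matchings_def perfect_matching_def complete_multipartite_def)
  thus ?thesis by blast
qed

section \<open>Switching a matching edge onto a given edge\<close>

definition switch :: "'a \<Rightarrow> 'a \<Rightarrow> 'a \<Rightarrow> 'a \<Rightarrow> 'a set set \<Rightarrow> 'a set set" where
  "switch u v u' v' M = (`) (Transposition.transpose u u' \<circ> Transposition.transpose v v') ` M"

text \<open>The sample space of the random experiment: a matching together with one of its edges
  between \<open>V i\<close> and \<open>V j\<close>. It is counted in two ways below.\<close>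

definition triples :: "'i \<Rightarrow> 'i \<Rightarrow> ('a set set \<times> 'a \<times> 'a) set" where
  "triples i j = (SIGMA M:\<M>. matched_pairs M i j)"

lemma finite_triples: "i \<in> I \<Longrightarrow> j \<in> I \<Longrightarrow> finite (triples i j)"
  by (simp add: triples_def finite_\<M> finite_matched_pairs)

text \<open>For fixed \<open>u'\<close> and \<open>v'\<close>, relabelling by
  \<open>\<sigma>\<close> is a bijection of \<open>\<M>\<close> with inverse relabelling by
  \<open>\<tau>\<close>, and it takes \<open>{u', v'}\<close> to \<open>{u, v}\<close>.\<close>

lemma card_switch:
  assumes ij: "i \<in> I" "j \<in> I" "i \<noteq> j"
    and uv: "u \<in> V i" "v \<in> V j" and uv': "u' \<in> V i" "v' \<in> V j"
  shows "card {M \<in> \<M>. {u', v'} \<in> M \<and> Q (switch u v u' v' M)} =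
         card {M \<in> \<M>. {u, v} \<in> M \<and> Q M}"
proof (rule bij_betw_same_card)
  define \<sigma> where "\<sigma> = Transposition.transpose u u' \<circ> Transposition.transpose v v'"
  define \<tau> where "\<tau> = Transposition.transpose v v' \<circ> Transposition.transpose u u'"
  have neq: "u \<noteq> v" "u \<noteq> v'" "u' \<noteq> v" "u' \<noteq> v'"
    using same_part ij uv uv' by blast+
  have "\<sigma> ` \<tau> ` f = f" "\<tau> ` \<sigma> ` f = f" for f
    by (simp_all add: \<sigma>_def \<tau>_def image_image)
  hence inverse: "(`) \<sigma> ` (`) \<tau> ` M = M" "(`) \<tau> ` (`) \<sigma> ` M = M" for M
    by (subst image_image, simp only: image_ident)+
  have "bij \<sigma>" "bij \<tau>"
    by (simp_all add: \<sigma>_def \<tau>_def bij_comp)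
  \<comment> \<open>\<open>u\<close> and \<open>u'\<close> share their part, and so do
    \<open>v\<close> and \<open>v'\<close>; hence both transpositions map each part onto
    itself.\<close>
  have iff: "u \<in> V a \<longleftrightarrow> u' \<in> V a" "v \<in> V a \<longleftrightarrow> v' \<in> V a" if "a \<in> I" for a
    using same_part that ij uv uv' by blast+
  hence parts: "\<sigma> ` V a = V a" "\<tau> ` V a = V a" if "a \<in> I" for a
    using that unfolding \<sigma>_def \<tau>_def image_comp [symmetric] by simp_all
  have \<sigma>_edge: "\<sigma> ` {u', v'} = {u, v}" and \<tau>_edge: "\<tau> ` {u, v} = {u', v'}"
    using neq by (auto simp: \<sigma>_def \<tau>_def)
  show "bij_betw ((`) ((`) \<sigma>)) {M \<in> \<M>. {u', v'} \<in> M \<and> Q (switch u v u' v' M)}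
          {M \<in> \<M>. {u, v} \<in> M \<and> Q M}"
  proof (rule bij_betw_byWitness[of _ "(`) ((`) \<tau>)"])
    show "(`) ((`) \<sigma>) ` {M \<in> \<M>. {u', v'} \<in> M \<and> Q (switch u v u' v' M)}
            \<subseteq> {M \<in> \<M>. {u, v} \<in> M \<and> Q M}"
    proof clarify
      fix M assume "M \<in> \<M>" "{u', v'} \<in> M" "Q (switch u v u' v' M)"
      moreover from this have "{u, v} \<in> (`) \<sigma> ` M"
        using imageI[of "{u', v'}" M "(`) \<sigma>"] unfolding \<sigma>_edge by blast
      ultimately show "(`) \<sigma> ` M \<in> \<M> \<and> {u, v} \<in> (`) \<sigma> ` M \<and> Q ((`) \<sigma> ` M)"
        using permuted_matching[OF _ \<open>bij \<sigma>\<close> parts(1)]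
        by (simp add: switch_def \<sigma>_def [symmetric])
    qed
    show "(`) ((`) \<tau>) ` {M \<in> \<M>. {u, v} \<in> M \<and> Q M}
            \<subseteq> {M \<in> \<M>. {u', v'} \<in> M \<and> Q (switch u v u' v' M)}"
    proof clarify
      fix M assume M: "M \<in> \<M>" "{u, v} \<in> M" "Q M"
      have "switch u v u' v' ((`) \<tau> ` M) = M"
        by (simp add: switch_def \<sigma>_def [symmetric] inverse)
      moreover have "{u', v'} \<in> (`) \<tau> ` M"
        using M imageI[of "{u, v}" M "(`) \<tau>"] unfolding \<tau>_edge by blast
      ultimately show "(`) \<tau> ` M \<in> \<M> \<and> {u', v'} \<in> (`) \<tau> ` M \<and> Q (switch u v u' v' ((`) \<tau> ` M))"
        using M permuted_matching[OF _ \<open>bij \<tau>\<close> parts(2)] by simp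
    qed
  qed (simp_all add: inverse)
qed

text \<open>Each of the \<open>s * s\<close> choices of \<open>(u', v')\<close> contributes the same
  number by \<open>card_switch\<close>. Hence switching a uniform triple yields a uniform matching
  among those containing \<open>{u, v}\<close>.\<close>

lemma card_triples_switch:
  assumes ij: "i \<in> I" "j \<in> I" "i \<noteq> j" and uv: "u \<in> V i" "v \<in> V j"
  shows "card {(M, u', v') \<in> triples i j. Q (switch u v u' v' M)} =
         s * s * card {M \<in> \<M>. {u, v} \<in> M \<and> Q M}"
proof -
  define S where "S = (SIGMA (u', v'):V i \<times> V j.
     {M \<in> \<M>. {u', v'} \<in> M \<and> Q (switch u v u' v' M)})"
  have "bij_betw prod.swap S {(M, u', v') \<in> triples i j. Q (switch u v u' v' M)}"
    by (rule bij_betw_byWitness[of _ prod.swap])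
       (auto simp: S_def triples_def matched_pairs_def)
  hence "card {(M, u', v') \<in> triples i j. Q (switch u v u' v' M)} = card S"
    by (simp add: bij_betw_same_card)
  also have "\<dots> = (\<Sum>(u', v')\<in>V i \<times> V j.
      card {M \<in> \<M>. {u', v'} \<in> M \<and> Q (switch u v u' v' M)})"
    unfolding S_def using ij finite_part finite_\<M>
    by (subst card_SigmaI) (auto simp: case_prod_unfold)
  also have "\<dots> = (\<Sum>(u', v')\<in>V i \<times> V j. card {M \<in> \<M>. {u, v} \<in> M \<and> Q M})"
    using card_switch[OF ij uv] by (intro sum.cong) auto
  also have "\<dots> = s * s * card {M \<in> \<M>. {u, v} \<in> M \<and> Q M}"
    using ij by (simp add: card_cartesian_product card_part_s)
  finally show ?thesis .
qed

text \<open>Forgetting the chosen edge is \<open>n\<close>-to-one, so the matching in a uniform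
  triple is uniform on \<open>\<M>\<close>.\<close>

lemma card_triples_matching:
  assumes ij: "i \<in> I" "j \<in> I" "i \<noteq> j"
  shows "card {(M, p) \<in> triples i j. Q M} = n * card {M \<in> \<M>. Q M}"
proof -
  have "{(M, p) \<in> triples i j. Q M} = (SIGMA M:{M \<in> \<M>. Q M}. matched_pairs M i j)"
    by (auto simp: triples_def)
  also have "card \<dots> = (\<Sum>M\<in>{M \<in> \<M>. Q M}. n)"
    using ij finite_\<M> finite_matched_pairs card_matched_pairs[OF _ ij]
    by (subst card_SigmaI) (auto intro!: sum.cong)
  finally show ?thesis by simp
qed

text \<open>Equating the two counts of all triples shows that a given edge lies in the random
  matching with probability \<open>n / s^2\<close>.\<close>

lemma card_containing:
  assumes "e \<in> edges (complete_multipartite I V)"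
  shows "s * s * card {M \<in> \<M>. e \<in> M} = n * card \<M>"
proof -
  obtain i j u v where ij: "i \<in> I" "j \<in> I" "i \<noteq> j" "u \<in> V i" "v \<in> V j" "e = {u, v}"
    using assms by (auto simp: complete_multipartite_def)
  have "{(M, u', v') \<in> triples i j. True} = triples i j"
    "{(M, p) \<in> triples i j. True} = triples i j" by auto
  with card_triples_switch[of i j u v "\<lambda>_. True"] card_triples_matching[of i j "\<lambda>_. True"] ij
  show ?thesis by simp
qed

lemma card_containing_real:
  assumes "e \<in> edges (complete_multipartite I V)"
  shows "real (card {M \<in> \<M>. e \<in> M}) = n / (real s * real s) * card \<M>"
  using arg_cong[OF card_containing[OF assms], of real] s_pos
  by (simp add: field_simps)

lemma card_containing_le:
  assumes "e \<in> edges (complete_multipartite I V)"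
  shows "real (card {M \<in> \<M>. e \<in> M}) \<le> card \<M> / s"
proof -
  have "n / (real s * real s) \<le> 1 / s"
    using n_le_s s_pos by (simp add: field_simps)
  from mult_right_mono[OF this, of "card \<M>"] show ?thesis
    by (simp add: card_containing_real[OF assms])
qed

end

section \<open>Triples on which the switch may disturb a sparse edge set\<close>

locale sparse_edge_set = equipartition I V n
  for I :: "'i set" and V :: "'i \<Rightarrow> 'a set" and n :: nat +
  fixes F :: "'a set set" and d :: nat
  assumes F_edges: "F \<subseteq> edges (complete_multipartite I V)"
    and degree_le: "\<And>v. card {e \<in> F. v \<in> e} \<le> d"
begin

lemma finite_F: "finite F"
  by (rule finite_subset[of _ "Pow (\<Union>i\<in>I. V i)"])
     (use F_edges finite_verts in \<open>auto simp: complete_multipartite_def\<close>)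

lemma card_F: "card F \<le> card I * s * d"
proof -
  have "F \<subseteq> (\<Union>v\<in>(\<Union>i\<in>I. V i). {e \<in> F. v \<in> e})"
    using F_edges by (fastforce simp: complete_multipartite_def)
  hence "card F \<le> card (\<Union>v\<in>(\<Union>i\<in>I. V i). {e \<in> F. v \<in> e})"
    by (rule card_mono[rotated]) (rule finite_subset[OF _ finite_F], auto)
  also have "\<dots> \<le> (\<Sum>v\<in>(\<Union>i\<in>I. V i). card {e \<in> F. v \<in> e})"
    by (rule card_UN_le[OF finite_verts])
  also have "\<dots> \<le> card (\<Union>i\<in>I. V i) * d"
    using sum_bounded_above[of "\<Union>i\<in>I. V i" "\<lambda>v. card {e \<in> F. v \<in> e}" d] degree_le by simp
  also have "card (\<Union>i\<in>I. V i) \<le> (\<Sum>i\<in>I. card (V i))"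
    by (rule card_UN_le[OF finite_I])
  also have "\<dots> = card I * s" by (simp add: card_part_s)
  finally show ?thesis by simp
qed

lemma card_F_neighbours: "card {x. {x, y} \<in> F} \<le> d"
  and finite_F_neighbours: "finite {x. {x, y} \<in> F}"
proof -
  have inj: "inj_on (\<lambda>x. {x, y}) {x. {x, y} \<in> F}"
    by (auto simp: inj_on_def doubleton_eq_iff)
  have sub: "(\<lambda>x. {x, y}) ` {x. {x, y} \<in> F} \<subseteq> {e \<in> F. y \<in> e}" by auto
  show "card {x. {x, y} \<in> F} \<le> d"
    using card_inj_on_le[OF inj sub] finite_F degree_le[of y] by simp
  show "finite {x. {x, y} \<in> F}"
    using inj_on_finite[OF inj sub] finite_F by simp
qed

text \<open>The set consists of \<open>w\<close> and of the vertices that, put in place of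
  \<open>w\<close>, would turn the matching edge at \<open>w\<close> into an edge of
  \<open>F\<close>. As \<open>w\<close> has at most one partner \<open>y\<close>, these are at most
  \<open>d\<close> neighbours of \<open>y\<close> in \<open>F\<close>.\<close>

lemma card_second_neighbours:
  assumes "M \<in> \<M>"
  shows "card {x. x = w \<or> (\<exists>y. {w, y} \<in> M \<and> {x, y} \<in> F)} \<le> d + 1 \<and>
         finite {x. x = w \<or> (\<exists>y. {w, y} \<in> M \<and> {x, y} \<in> F)}"
proof (cases "\<exists>y. {w, y} \<in> M")
  case True
  then obtain y where y: "{w, y} \<in> M" by blast
  hence "{x. x = w \<or> (\<exists>y. {w, y} \<in> M \<and> {x, y} \<in> F)} = insert w {x. {x, y} \<in> F}"
    using partner_unique[OF assms y] y by blast
  thus ?thesis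
    using card_F_neighbours[of y] finite_F_neighbours[of y] by (simp add: card_insert_if)
next
  case False
  hence "{x. x = w \<or> (\<exists>y. {w, y} \<in> M \<and> {x, y} \<in> F)} = {w}" by auto
  thus ?thesis by simp
qed

text \<open>
  The cases \<open>u' = u\<close> and \<open>v' = v\<close> would be harmless; discarding them ensures that outside \<open>bad\<close>
  the switch moves exactly the three distinct edges at \<open>u\<close>, at \<open>v\<close> and at \<open>u'v'\<close>.
\<close>
definition bad :: "'i \<Rightarrow> 'i \<Rightarrow> 'a \<Rightarrow> 'a \<Rightarrow> ('a set set \<times> 'a \<times> 'a) set" where
  "bad i j u v = {(M, u', v') \<in> triples i j. {u', v'} \<in> F \<or>
     (\<exists>f\<in>M \<inter> F. u \<in> f) \<or> (\<exists>f\<in>M \<inter> F. v \<in> f) \<or>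
     (u' = u \<or> (\<exists>y. {u, y} \<in> M \<and> {u', y} \<in> F)) \<or>
     (v' = v \<or> (\<exists>y. {v, y} \<in> M \<and> {v', y} \<in> F))}"

text \<open>Union bound over the at most \<open>d\<close> edges of \<open>F\<close> at
  \<open>w\<close>, each of which lies in a random matching with probability at most
  \<open>1 / s\<close>; every matching accounts for \<open>n \<le> s\<close> triples.\<close>

lemma card_bad_incident:
  assumes ij: "i \<in> I" "j \<in> I" "i \<noteq> j"
  shows "real (card {(M, p) \<in> triples i j. \<exists>f\<in>M \<inter> F. w \<in> f}) \<le> d * card \<M>"
proof -
  have "card {M \<in> \<M>. \<exists>f\<in>M \<inter> F. w \<in> f} \<le> card (\<Union>f\<in>{f \<in> F. w \<in> f}. {M \<in> \<M>. f \<in> M})"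
    using finite_F finite_\<M> by (intro card_mono) auto
  also have "\<dots> \<le> (\<Sum>f\<in>{f \<in> F. w \<in> f}. card {M \<in> \<M>. f \<in> M})"
    using finite_F by (intro card_UN_le) auto
  finally have "real (card {M \<in> \<M>. \<exists>f\<in>M \<inter> F. w \<in> f})
      \<le> (\<Sum>f\<in>{f \<in> F. w \<in> f}. real (card {M \<in> \<M>. f \<in> M}))"
    by (simp flip: of_nat_sum)
  also have "\<dots> \<le> card {f \<in> F. w \<in> f} * (card \<M> / s)"
    using card_containing_le F_edges by (intro sum_bounded_above) blast
  also have "\<dots> \<le> d * (card \<M> / s)"
    using degree_le by (intro mult_right_mono) auto
  finally have *: "real (card {M \<in> \<M>. \<exists>f\<in>M \<inter> F. w \<in> f}) \<le> d * (card \<M> / s)" .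
  have "real (card {(M, p) \<in> triples i j. \<exists>f\<in>M \<inter> F. w \<in> f})
      = n * real (card {M \<in> \<M>. \<exists>f\<in>M \<inter> F. w \<in> f})"
    using card_triples_matching[OF ij] by simp
  also have "\<dots> \<le> s * (d * (card \<M> / s))"
    using n_le_s * by (intro mult_mono) auto
  also have "\<dots> = d * card \<M>" using s_pos by simp
  finally show ?thesis .
qed

text \<open>The parts determine the orientation of the chosen edge, so a triple is recovered from
  that edge and the matching. The factor \<open>s\<close> in the bound on \<open>card F\<close>
  cancels the probability bound \<open>1 / s\<close>.\<close>

lemma card_bad_chosen_edge:
  assumes ij: "i \<in> I" "j \<in> I" "i \<noteq> j"
  shows "real (card {(M, u', v') \<in> triples i j. {u', v'} \<in> F}) \<le> card I * d * card \<M>"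
proof -
  define S where "S = (SIGMA f:F. {M \<in> \<M>. f \<in> M})"
  define g where "g = (\<lambda>(M, u', v'). ({u', v' :: 'a}, M :: 'a set set))"
  have "inj_on g {(M, u', v') \<in> triples i j. {u', v'} \<in> F}"
    using ij same_part
    by (fastforce simp: inj_on_def g_def triples_def matched_pairs_def doubleton_eq_iff)
  moreover have "g ` {(M, u', v') \<in> triples i j. {u', v'} \<in> F} \<subseteq> S"
    by (auto simp: g_def S_def triples_def matched_pairs_def)
  moreover have "finite S" using finite_F finite_\<M> by (auto simp: S_def)
  ultimately have "card {(M, u', v') \<in> triples i j. {u', v'} \<in> F} \<le> card S"
    by (rule card_inj_on_le)
  also have "card S = (\<Sum>f\<in>F. card {M \<in> \<M>. f \<in> M})"
    unfolding S_def using finite_F finite_\<M> by (subst card_SigmaI) auto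
  finally have "real (card {(M, u', v') \<in> triples i j. {u', v'} \<in> F})
      \<le> (\<Sum>f\<in>F. real (card {M \<in> \<M>. f \<in> M}))"
    by (simp flip: of_nat_sum)
  also have "\<dots> \<le> card F * (card \<M> / s)"
    using card_containing_le F_edges by (intro sum_bounded_above) blast
  also have "\<dots> \<le> real (card I * s * d) * (card \<M> / s)"
    using card_F by (intro mult_right_mono of_nat_mono) auto
  also have "\<dots> = card I * d * card \<M>" using s_pos by simp
  finally show ?thesis .
qed

text \<open>For a fixed matching, \<open>u'\<close> takes at most \<open>d + 1\<close> values by
  \<open>card_second_neighbours\<close>, and it determines \<open>v'\<close> as its partner.\<close>

lemma card_bad_triples_fst:
  assumes ij: "i \<in> I" "j \<in> I" "i \<noteq> j"
  shows "card {(M, u', v') \<in> triples i j. u' = u \<or> (\<exists>y. {u, y} \<in> M \<and> {u', y} \<in> F)}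
           \<le> (d + 1) * card \<M>"
proof -
  define T where "T = (\<lambda>M. {(u', v') \<in> matched_pairs M i j.
                        u' = u \<or> (\<exists>y. {u, y} \<in> M \<and> {u', y} \<in> F)})"
  have "card (T M) \<le> d + 1" if M: "M \<in> \<M>" for M
  proof -
    have "inj_on fst (T M)"
      using partner_unique[OF M] by (auto simp: inj_on_def T_def matched_pairs_def)
    hence "card (T M) \<le> card {x. x = u \<or> (\<exists>y. {u, y} \<in> M \<and> {x, y} \<in> F)}"
      using card_second_neighbours[OF M, of u] by (intro card_inj_on_le) (auto simp: T_def)
    with card_second_neighbours[OF M, of u] show ?thesis by linarith
  qed
  moreover have "finite (T M)" for M
    using finite_matched_pairs[OF ij(1,2), of M]
    by (rule finite_subset[rotated]) (auto simp: T_def)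
  moreover have "{(M, u', v') \<in> triples i j. u' = u \<or> (\<exists>y. {u, y} \<in> M \<and> {u', y} \<in> F)}
      = (SIGMA M:\<M>. T M)"
    by (auto simp: T_def triples_def)
  ultimately show ?thesis
    using sum_bounded_above[of \<M> "\<lambda>M. card (T M)" "d + 1"] finite_\<M>
    by (simp add: card_SigmaI mult.commute)
qed

lemma card_bad_triples_snd:
  assumes ij: "i \<in> I" "j \<in> I" "i \<noteq> j"
  shows "card {(M, u', v') \<in> triples i j. v' = v \<or> (\<exists>y. {v, y} \<in> M \<and> {v', y} \<in> F)}
           \<le> (d + 1) * card \<M>"
proof -
  have "bij_betw (\<lambda>(M, u', v'). (M, v', u'))
      {(M, u', v') \<in> triples i j. v' = v \<or> (\<exists>y. {v, y} \<in> M \<and> {v', y} \<in> F)}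
      {(M, u', v') \<in> triples j i. u' = v \<or> (\<exists>y. {v, y} \<in> M \<and> {u', y} \<in> F)}"
    by (rule bij_betw_byWitness[of _ "\<lambda>(M, u', v'). (M, v', u')"])
       (auto simp: triples_def matched_pairs_def insert_commute)
  from bij_betw_same_card[OF this] show ?thesis
    using card_bad_triples_fst[of j i v] ij by simp
qed

text \<open>The contributions are \<open>card I * d\<close> for a chosen edge in \<open>F\<close>,
  \<open>d\<close> for an edge of \<open>F\<close> at each of \<open>u\<close> and \<open>v\<close>,
  and \<open>d + 1\<close> for each of the conditions on \<open>u'\<close> and \<open>v'\<close>.
  The value does not involve \<open>n\<close>, so bad triples are a share of order
  \<open>1 / n\<close> of all \<open>n * card \<M>\<close> triples.\<close>

definition bad_bound :: real where
  "bad_bound = card I * d + 4 * d + 2"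

lemma card_bad:
  assumes ij: "i \<in> I" "j \<in> I" "i \<noteq> j"
  shows "real (card (bad i j u v)) \<le> bad_bound * card \<M>"
proof -
  define T1 where "T1 = {(M, u', v') \<in> triples i j. {u', v'} \<in> F}"
  define T2 where "T2 = (\<lambda>w. {(M, p) \<in> triples i j. \<exists>f\<in>M \<inter> F. w \<in> f})"
  define T3 where "T3 = {(M, u', v') \<in> triples i j. u' = u \<or> (\<exists>y. {u, y} \<in> M \<and> {u', y} \<in> F)}"
  define T4 where "T4 = {(M, u', v') \<in> triples i j. v' = v \<or> (\<exists>y. {v, y} \<in> M \<and> {v', y} \<in> F)}"
  have bad_eq: "bad i j u v = T1 \<union> (T2 u \<union> (T2 v \<union> (T3 \<union> T4)))"
    unfolding bad_def T1_def T2_def T3_def T4_def by blast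
  have "card (bad i j u v) \<le> card T1 + (card (T2 u) + (card (T2 v) + (card T3 + card T4)))"
    unfolding bad_eq using card_Un_le[of T1 "T2 u \<union> (T2 v \<union> (T3 \<union> T4))"]
      card_Un_le[of "T2 u" "T2 v \<union> (T3 \<union> T4)"] card_Un_le[of "T2 v" "T3 \<union> T4"]
      card_Un_le[of T3 T4] by linarith
  hence "real (card (bad i j u v)) \<le>
      real (card T1) + (real (card (T2 u)) + (real (card (T2 v)) + (real (card T3) + real (card T4))))"
    by linarith
  also have "\<dots> \<le> card I * d * card \<M> + (d * card \<M> + (d * card \<M> +
      (real ((d + 1) * card \<M>) + real ((d + 1) * card \<M>))))"
    using card_bad_chosen_edge[OF ij] card_bad_incident[OF ij, of u]
      card_bad_incident[OF ij, of v] of_nat_mono[OF card_bad_triples_fst[OF ij, of u]]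
      of_nat_mono[OF card_bad_triples_snd[OF ij, of v]]
    unfolding T1_def T2_def T3_def T4_def of_nat_mult by (intro add_mono)
  also have "\<dots> = bad_bound * card \<M>"
    by (simp add: bad_bound_def algebra_simps)
  finally show ?thesis .
qed

text \<open>A matching edge in \<open>F\<close> avoids \<open>u\<close>, \<open>v\<close>,
  \<open>u'\<close> and \<open>v'\<close>, so it stays. The chosen edge moves to
  \<open>{u, v}\<close>, and the edges at \<open>u\<close> and \<open>v\<close> move to edges
  outside \<open>F\<close>. A general \<open>E \<subseteq> F\<close> allows the effect to be read
  off for each graph separately.\<close>

lemma switch_Int:
  assumes ij: "i \<in> I" "j \<in> I" "i \<noteq> j" and uv: "u \<in> V i" "v \<in> V j" "{u, v} \<in> F"
    and good: "(M, u', v') \<in> triples i j" "(M, u', v') \<notin> bad i j u v" and E: "E \<subseteq> F"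
  shows "switch u v u' v' M \<inter> E = M \<inter> E \<union> {{u, v}} \<inter> E" and "{u, v} \<notin> M"
proof -
  define \<sigma> where "\<sigma> = Transposition.transpose u u' \<circ> Transposition.transpose v v'"
  have M: "M \<in> \<M>" and uv': "u' \<in> V i" "v' \<in> V j" "{u', v'} \<in> M"
    using good(1) by (auto simp: triples_def matched_pairs_def)
  have neq: "u \<noteq> v" "u \<noteq> v'" "u' \<noteq> v" "u' \<noteq> v'"
    using same_part ij uv uv' by blast+
  have T1: "{u', v'} \<notin> F" and T2: "\<And>f. f \<in> M \<Longrightarrow> f \<in> F \<Longrightarrow> u \<notin> f \<and> v \<notin> f"
    and T3: "u' \<noteq> u" "\<And>y. {u, y} \<in> M \<Longrightarrow> {u', y} \<notin> F"
    and T4: "v' \<noteq> v" "\<And>y. {v, y} \<in> M \<Longrightarrow> {v', y} \<notin> F"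
    using good by (auto simp: bad_def)
  show "{u, v} \<notin> M" using T2 uv by blast
  have \<sigma>_edge: "\<sigma> ` {u', v'} = {u, v}" using neq by (auto simp: \<sigma>_def)
  have \<sigma>_id: "\<sigma> ` f = f" if "u \<notin> f" "v \<notin> f" "u' \<notin> f" "v' \<notin> f" for f
    using that unfolding \<sigma>_def image_comp [symmetric] by simp
  have chosen: "f = {u', v'}" if "f \<in> M" "u' \<in> f \<or> v' \<in> f" for f
    using edge_unique[OF M that(1) uv'(3)] that(2) by blast
  have keep: "\<sigma> ` f = f" if f: "f \<in> M" "f \<in> F" for f
    using T2[OF f] chosen[OF f(1)] T1 f(2) by (intro \<sigma>_id) auto
  \<comment> \<open>Only the chosen edge and the edges at \<open>u\<close> and \<open>v\<close> can
    move. An edge \<open>{u, y}\<close> becomes \<open>{u', y}\<close>, which \<open>T3\<close>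
    keeps out of \<open>F\<close>; for \<open>{v, y}\<close> the same follows from
    \<open>T4\<close>.\<close>
  have new: "\<sigma> ` f = {u, v} \<or> \<sigma> ` f = f" if f: "f \<in> M" "\<sigma> ` f \<in> F" for f
  proof (rule ccontr)
    assume *: "\<not> ?thesis"
    hence ne: "f \<noteq> {u', v'}" using \<sigma>_edge by auto
    hence "u' \<notin> f" "v' \<notin> f" using chosen f(1) by blast+
    have "u \<in> f \<or> v \<in> f" using * \<sigma>_id \<open>u' \<notin> f\<close> \<open>v' \<notin> f\<close> by blast
    moreover obtain a b where ab: "f = {a, b}" using M f(1) by (elim matching_edge)
    ultimately obtain y where y: "f = {u, y} \<or> f = {v, y}"
      by (auto simp: insert_commute)
    thus False
    proof
      assume fy: "f = {u, y}"
      have "y \<noteq> v" using fy f(1) \<open>{u, v} \<notin> M\<close> by blast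
      moreover have "y \<noteq> u"
        using fy M f(1) same_part by (elim matching_edge) (auto simp: doubleton_eq_iff)
      ultimately have "\<sigma> ` f = {u', y}"
        using fy \<open>u' \<notin> f\<close> \<open>v' \<notin> f\<close> neq by (auto simp: \<sigma>_def)
      with f fy T3(2) show False by auto
    next
      assume fy: "f = {v, y}"
      have "y \<noteq> u" using fy f(1) \<open>{u, v} \<notin> M\<close> by (auto simp: insert_commute)
      moreover have "y \<noteq> v"
        using fy M f(1) same_part by (elim matching_edge) (auto simp: doubleton_eq_iff)
      ultimately have "\<sigma> ` f = {v', y}"
        using fy \<open>u' \<notin> f\<close> \<open>v' \<notin> f\<close> neq by (auto simp: \<sigma>_def)
      with f fy T4(2) show False by auto
    qed
  qed
  have sw: "switch u v u' v' M = (`) \<sigma> ` M" by (simp add: switch_def \<sigma>_def)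
  show "switch u v u' v' M \<inter> E = M \<inter> E \<union> {{u, v}} \<inter> E"
  proof (intro equalityI subsetI)
    fix x assume "x \<in> switch u v u' v' M \<inter> E"
    then obtain f where "f \<in> M" "x = \<sigma> ` f" "x \<in> E" "x \<in> F" using sw E by auto
    with new[of f] show "x \<in> M \<inter> E \<union> {{u, v}} \<inter> E" by auto
  next
    fix x assume x: "x \<in> M \<inter> E \<union> {{u, v}} \<inter> E"
    show "x \<in> switch u v u' v' M \<inter> E"
    proof (cases "x = {u, v}")
      case True
      with x uv'(3) \<sigma>_edge show ?thesis by (auto simp: sw intro!: image_eqI[of _ _ "{u', v'}"])
    next
      case False
      with x E have "x \<in> M" "x \<in> E" "\<sigma> ` x = x" using keep by auto
      thus ?thesis unfolding sw by (metis IntI image_eqI)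
    qed
  qed
qed

text \<open>The triples with \<open>Q\<close> after the switch and those with \<open>Q'\<close>
  before it number \<open>s * s\<close> and \<open>n\<close> times the two cardinalities, and the
  two sets of triples differ only inside \<open>bad\<close>.\<close>

lemma switch_count_error:
  assumes ij: "i \<in> I" "j \<in> I" "i \<noteq> j" and uv: "u \<in> V i" "v \<in> V j"
    and iff: "\<And>M u' v'. (M, u', v') \<in> triples i j \<Longrightarrow> (M, u', v') \<notin> bad i j u v \<Longrightarrow>
                Q (switch u v u' v' M) \<longleftrightarrow> Q' M"
  shows "\<bar>real (s * s) * card {M \<in> \<M>. {u, v} \<in> M \<and> Q M} - real n * card {M \<in> \<M>. Q' M}\<bar>
           \<le> bad_bound * card \<M>"
proof -
  define S where "S = {(M, u', v') \<in> triples i j. Q (switch u v u' v' M)}"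
  define S' where "S' = {(M, p) \<in> triples i j. Q' M}"
  have fin: "finite S" "finite S'" "finite (bad i j u v)"
    by (rule finite_subset[OF _ finite_triples[OF ij(1,2)]]; force simp: S_def S'_def bad_def)+
  have "S \<subseteq> S' \<union> bad i j u v" "S' \<subseteq> S \<union> bad i j u v"
    using iff by (auto simp: S_def S'_def)
  hence "card S \<le> card S' + card (bad i j u v)" "card S' \<le> card S + card (bad i j u v)"
    using fin by (meson card_Un_le card_mono finite_UnI le_trans)+
  hence "\<bar>real (card S) - real (card S')\<bar> \<le> real (card (bad i j u v))" by linarith
  also have "\<dots> \<le> bad_bound * card \<M>" by (rule card_bad[OF ij])
  finally show ?thesis
    using card_triples_switch[OF ij uv, of Q] card_triples_matching[OF ij, of Q']
    by (simp add: S_def S'_def)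
qed

end

section \<open>Laws that almost satisfy the Poisson recurrence\<close>

lemma summable_on_pmf: "pmf p summable_on A"
  using pmf_abs_summable[of p A] abs_summable_equivalent[of "pmf p" A] by simp

lemma infsum_pmf: "infsum (pmf p) A = measure_pmf.prob p A"
  by (simp add: measure_pmf_conv_infsetsum infsetsum_infsum pmf_abs_summable)

section \<open>Tails and recurrence of the Poisson product law\<close>

text \<open>For \<open>k \<ge> N\<close> the mass at \<open>k + 1\<close> is
  \<open>rate / (k + 1)\<close> times the mass at \<open>k\<close>, hence at most
  \<open>rate / (N + 1)\<close> times it. Summing over these \<open>k\<close> leaves this factor
  times a probability.\<close>

lemma poisson0_tail:
  assumes "rate \<ge> 0"
  shows "measure_pmf.prob (poisson0_pmf rate) {N<..} \<le> rate / (N + 1)"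
proof -
  have Suc_range: "{N<..} = Suc ` {N..}"
  proof (intro equalityI subsetI)
    fix x assume "x \<in> {N<..}"
    thus "x \<in> Suc ` {N..}" by (cases x) auto
  qed auto
  have "measure_pmf.prob (poisson0_pmf rate) {N<..} = infsum (pmf (poisson0_pmf rate)) (Suc ` {N..})"
    by (simp add: infsum_pmf Suc_range)
  also have "\<dots> = infsum (\<lambda>k. pmf (poisson0_pmf rate) (Suc k)) {N..}"
    by (subst infsum_reindex) (auto simp: o_def)
  also have "\<dots> \<le> infsum (\<lambda>k. rate / (N + 1) * pmf (poisson0_pmf rate) k) {N..}"
  proof (rule infsum_mono)
    have "pmf (poisson0_pmf rate) summable_on Suc ` {N..}" by (rule summable_on_pmf)
    thus "(\<lambda>k. pmf (poisson0_pmf rate) (Suc k)) summable_on {N..}"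
      by (subst (asm) summable_on_reindex) (auto simp: o_def)
    show "(\<lambda>k. rate / (N + 1) * pmf (poisson0_pmf rate) k) summable_on {N..}"
      by (intro summable_on_cmult_right summable_on_pmf)
    fix k assume k: "k \<in> {N..}"
    have "pmf (poisson0_pmf rate) (Suc k) = rate / (k + 1) * pmf (poisson0_pmf rate) k"
      using assms by (simp add: pmf_poisson0 field_simps)
    also have "\<dots> \<le> rate / (N + 1) * pmf (poisson0_pmf rate) k"
      using assms k by (intro mult_right_mono divide_left_mono) auto
    finally show "pmf (poisson0_pmf rate) (Suc k) \<le> rate / (N + 1) * pmf (poisson0_pmf rate) k" .
  qed
  also have "\<dots> = rate / (N + 1) * measure_pmf.prob (poisson0_pmf rate) {N..}"
    by (subst infsum_cmult_right) (auto simp: summable_on_pmf infsum_pmf)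
  also have "\<dots> \<le> rate / (N + 1) * 1"
    using assms by (intro mult_left_mono) auto
  finally show ?thesis by simp
qed

lemma Pi_poisson0_tail:
  assumes "finite A" "m \<in> A" "rate m \<ge> 0"
  shows "measure_pmf.prob (Pi_pmf A 0 (\<lambda>m. poisson0_pmf (rate m))) {k. N < k m} \<le> rate m / (N + 1)"
proof -
  have "measure_pmf.prob (Pi_pmf A 0 (\<lambda>m. poisson0_pmf (rate m))) {k. N < k m} =
        measure_pmf.prob (map_pmf (\<lambda>k. k m) (Pi_pmf A 0 (\<lambda>m. poisson0_pmf (rate m)))) {N<..}"
    by (simp add: vimage_def greaterThan_def)
  also have "\<dots> = measure_pmf.prob (poisson0_pmf (rate m)) {N<..}"
    using assms by (simp add: Pi_pmf_component)
  finally show ?thesis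
    using poisson0_tail[OF assms(3), of N] by simp
qed

text \<open>Only the factor at \<open>m\<close> changes, where the one-dimensional recurrence
  applies. A vector that is nonzero somewhere outside \<open>A\<close> remains so when raised at
  \<open>m \<in> A\<close>, and then both sides vanish.\<close>

lemma pmf_Pi_poisson0_Suc:
  assumes "finite A" "m \<in> A" "rate m \<ge> 0"
  shows "real (Suc (k m)) * pmf (Pi_pmf A 0 (\<lambda>m. poisson0_pmf (rate m))) (k(m := Suc (k m))) =
         rate m * pmf (Pi_pmf A 0 (\<lambda>m. poisson0_pmf (rate m))) k"
proof (cases "\<forall>x. x \<notin> A \<longrightarrow> k x = 0")
  case True
  let ?P = "Pi_pmf A 0 (\<lambda>m. poisson0_pmf (rate m))"
  have "pmf ?P (k(m := Suc (k m))) = (\<Prod>x\<in>A. pmf (poisson0_pmf (rate x)) ((k(m := Suc (k m))) x))"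
    using assms True by (intro pmf_Pi') auto
  also have "\<dots> =
        pmf (poisson0_pmf (rate m)) (Suc (k m)) * (\<Prod>x\<in>A - {m}. pmf (poisson0_pmf (rate x)) (k x))"
    using assms by (subst prod.remove[of _ m]) (auto intro!: prod.cong)
  finally have "pmf ?P (k(m := Suc (k m))) = \<dots>" .
  moreover have "pmf ?P k = (\<Prod>x\<in>A. pmf (poisson0_pmf (rate x)) (k x))"
    using assms True by (intro pmf_Pi') auto
  moreover have "\<dots> =
        pmf (poisson0_pmf (rate m)) (k m) * (\<Prod>x\<in>A - {m}. pmf (poisson0_pmf (rate x)) (k x))"
    using assms by (subst prod.remove[of _ m]) auto
  moreover have "real (Suc (k m)) * pmf (poisson0_pmf (rate m)) (Suc (k m)) =
        rate m * pmf (poisson0_pmf (rate m)) (k m)"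
    using assms by (simp add: pmf_poisson0 divide_simps)
  ultimately show ?thesis
    by (simp only: mult.assoc [symmetric])
next
  case False
  hence "\<exists>x. x \<notin> A \<and> k x \<noteq> 0" "\<exists>x. x \<notin> A \<and> (k(m := Suc (k m))) x \<noteq> 0"
    using assms(2) by auto
  thus ?thesis using assms(1) by (simp only: pmf_Pi_outside)
qed

text \<open>Lets the mass at the origin serve as the denominator of the constant of
  proportionality.\<close>

lemma pmf_Pi_poisson0_zero_pos:
  assumes "finite A" "\<And>m. m \<in> A \<Longrightarrow> rate m \<ge> 0"
  shows "pmf (Pi_pmf A 0 (\<lambda>m. poisson0_pmf (rate m))) (\<lambda>_. 0) > 0"
  using assms by (auto simp: pmf_Pi' pmf_poisson0 intro!: prod_pos)

section \<open>Comparison of two laws on a finite box\<close>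

definition box :: "nat \<Rightarrow> nat \<Rightarrow> (nat \<Rightarrow> nat) set" where
  "box l N = PiE_dflt {1..l} 0 (\<lambda>_. {..N})"

lemma finite_box: "finite (box l N)"
  by (auto simp: box_def)

lemma card_box: "card (box l N) = (N + 1) ^ l"
  by (simp add: box_def card_PiE_dflt)

lemma sum_le_on_box: "k \<in> box l N \<Longrightarrow> (\<Sum>m\<in>{1..l}. k m) \<le> l * N"
  using sum_bounded_above[of "{1..l}" k N] by (auto simp: box_def PiE_dflt_def)

text \<open>A vector of \<open>nat_vectors l\<close> outside the box exceeds \<open>N\<close> in
  some coordinate; union bound over the \<open>l\<close> coordinates.\<close>

lemma prob_nat_vectors_minus_box:
  assumes "\<And>m. m \<in> {1..l} \<Longrightarrow> measure_pmf.prob p {k. N < k m} \<le> t"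
  shows "measure_pmf.prob p (nat_vectors l - box l N) \<le> real l * t"
proof -
  have "nat_vectors l - box l N \<subseteq> (\<Union>m\<in>{1..l}. {k. N < k m})"
    by (auto simp: nat_vectors_def box_def PiE_dflt_def not_le)
  hence "measure_pmf.prob p (nat_vectors l - box l N) \<le> measure_pmf.prob p (\<Union>m\<in>{1..l}. {k. N < k m})"
    by (intro measure_pmf.finite_measure_mono) auto
  also have "\<dots> \<le> (\<Sum>m\<in>{1..l}. measure_pmf.prob p {k. N < k m})"
    by (intro measure_pmf.finite_measure_subadditive_finite) auto
  also have "\<dots> \<le> real (card {1..l}) * t"
    using assms by (intro sum_bounded_above) auto
  finally show ?thesis by simp
qed

lemma prob_box:
  assumes "set_pmf p \<subseteq> nat_vectors l"
    and "\<And>m. m \<in> {1..l} \<Longrightarrow> measure_pmf.prob p {k. N < k m} \<le> t"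
  shows "(\<Sum>k\<in>box l N. pmf p k) \<ge> 1 - real l * t" "(\<Sum>k\<in>box l N. pmf p k) \<le> 1"
proof -
  have box: "(\<Sum>k\<in>box l N. pmf p k) = measure_pmf.prob p (box l N)"
    by (simp add: measure_measure_pmf_finite finite_box)
  thus "(\<Sum>k\<in>box l N. pmf p k) \<le> 1" by simp
  have "1 = measure_pmf.prob p (nat_vectors l)"
    using assms(1) by (simp add: measure_pmf.prob_eq_1 AE_measure_pmf_iff subset_iff)
  also have "\<dots> \<le> measure_pmf.prob p (box l N \<union> (nat_vectors l - box l N))"
    by (intro measure_pmf.finite_measure_mono) auto
  also have "\<dots> = measure_pmf.prob p (box l N) + measure_pmf.prob p (nat_vectors l - box l N)"
    by (intro measure_pmf.finite_measure_Union) auto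
  also have "measure_pmf.prob p (nat_vectors l - box l N) \<le> real l * t"
    by (rule prob_nat_vectors_minus_box[OF assms(2)])
  finally show "(\<Sum>k\<in>box l N. pmf p k) \<ge> 1 - real l * t"
    using box by simp
qed

text \<open>Off the box the difference is at most the sum of the two masses, so pointwise control is
  needed at finitely many vectors only.\<close>

lemma dist_TV_le_box:
  "dist_TV l p q \<le> (\<Sum>k\<in>box l N. \<bar>pmf p k - pmf q k\<bar>) +
     measure_pmf.prob p (nat_vectors l - box l N) + measure_pmf.prob q (nat_vectors l - box l N)"
proof -
  let ?f = "\<lambda>k. \<bar>pmf p k - pmf q k\<bar>"
  let ?R = "nat_vectors l - box l N"
  have sub: "box l N \<subseteq> nat_vectors l"
    by (auto simp: nat_vectors_def box_def PiE_dflt_def)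
  have "dist_TV l p q = infsum ?f (box l N \<union> ?R)"
    using sub by (simp add: dist_TV_def Un_absorb1)
  also have "\<dots> = infsum ?f (box l N) + infsum ?f ?R"
    by (rule infsum_Un_disjoint) (auto simp: dist_TV_summable)
  also have "infsum ?f (box l N) = (\<Sum>k\<in>box l N. ?f k)"
    by (simp add: finite_box)
  also have "infsum ?f ?R \<le> infsum (\<lambda>k. pmf p k + pmf q k) ?R"
    by (rule infsum_mono)
       (auto simp: dist_TV_summable abs_le_iff intro!: summable_on_add summable_on_pmf)
  also have "\<dots> = infsum (pmf p) ?R + infsum (pmf q) ?R"
    by (rule infsum_add) (auto simp: summable_on_pmf)
  finally show ?thesis by (simp add: infsum_pmf)
qed

text \<open>The recurrence propagates values from the origin, so \<open>p\<close> is compared with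
  the multiple of \<open>q\<close> that agrees with it there. In the induction on the coordinate
  sum, a unit step turns an error \<open>\<epsilon> * c\<close> into at most
  \<open>\<epsilon> * (1 + \<Lambda> * c)\<close>, whence the geometric sum.\<close>

lemma near_multiple_of_recurrence_solution:
  fixes p q :: "(nat \<Rightarrow> nat) \<Rightarrow> real"
  assumes q: "\<And>k m. m \<in> {1..l} \<Longrightarrow> real (Suc (k m)) * q (k(m := Suc (k m))) = lam m * q k"
    and p: "\<And>k m. m \<in> {1..l} \<Longrightarrow>
              \<bar>real (Suc (k m)) * p (k(m := Suc (k m))) - lam m * p k\<bar> \<le> \<epsilon>"
    and lam: "\<And>m. m \<in> {1..l} \<Longrightarrow> 0 \<le> lam m \<and> lam m \<le> \<Lambda>"
    and zero: "p (\<lambda>_. 0) = a * q (\<lambda>_. 0)"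
    and k: "k \<in> nat_vectors l"
  shows "\<bar>p k - a * q k\<bar> \<le> \<epsilon> * (\<Sum>i<(\<Sum>m\<in>{1..l}. k m). \<Lambda> ^ i)"
  using k
proof (induction "\<Sum>m\<in>{1..l}. k m" arbitrary: k)
  case 0
  hence "k = (\<lambda>_. 0)" by (force simp: nat_vectors_def PiE_dflt_def)
  thus ?case using zero by simp
next
  case (Suc s)
  then obtain m where m: "m \<in> {1..l}" "k m > 0"
    by (metis gr0I sum.neutral nat.distinct(1))
  define k' where "k' = k(m := k m - 1)"
  have k': "k = k'(m := Suc (k' m))" "k' \<in> nat_vectors l"
    using m Suc.prems by (auto simp: k'_def nat_vectors_def PiE_dflt_def)
  have "(\<Sum>m\<in>{1..l}. k m) = k m + (\<Sum>m\<in>{1..l}-{m}. k m)"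
    using m by (subst sum.remove[of _ m]) auto
  moreover have "(\<Sum>m\<in>{1..l}. k' m) = (k m - 1) + (\<Sum>m\<in>{1..l}-{m}. k m)"
    using m by (subst sum.remove[of _ m]) (auto simp: k'_def intro!: sum.cong)
  ultimately have s: "s = (\<Sum>m\<in>{1..l}. k' m)" using Suc.hyps(2) m by linarith
  define c where "c = (\<Sum>i<s. \<Lambda> ^ i)"
  have IH: "\<bar>p k' - a * q k'\<bar> \<le> \<epsilon> * c"
    using Suc.hyps(1)[OF s k'(2)] by (simp add: c_def s)
  have \<Lambda>: "0 \<le> lam m" "lam m \<le> \<Lambda>" using lam m by auto
  \<comment> \<open>The factor is at least \<open>1\<close>; inserting it produces the left-hand
    sides of both recurrences.\<close>
  have "\<bar>p k - a * q k\<bar> \<le> real (Suc (k' m)) * \<bar>p k - a * q k\<bar>"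
    by (simp add: mult_le_cancel_right1)
  also have "\<dots> = \<bar>real (Suc (k' m)) * (p k - a * q k)\<bar>"
    by (simp add: abs_mult)
  also have "\<dots> = \<bar>real (Suc (k' m)) * p k - a * (real (Suc (k' m)) * q k)\<bar>"
    by (simp add: algebra_simps del: of_nat_Suc)
  \<comment> \<open>The recurrence of \<open>q\<close> is exact, so \<open>Suc (k' m) * q k\<close>
    becomes \<open>lam m * q k'\<close>; the term \<open>lam m * p k'\<close> is subtracted and
    added back.\<close>
  also have "\<dots> = \<bar>(real (Suc (k' m)) * p k - lam m * p k') + lam m * (p k' - a * q k')\<bar>"
    using q[OF m(1), of k'] k'(1) by (simp add: algebra_simps del: of_nat_Suc)
  also have "\<dots> \<le> \<bar>real (Suc (k' m)) * p k - lam m * p k'\<bar> + \<bar>lam m * (p k' - a * q k')\<bar>"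
    by (rule abs_triangle_ineq)
  also have "\<dots> \<le> \<epsilon> + \<Lambda> * (\<epsilon> * c)"
    using p[OF m(1), of k'] k'(1) IH \<Lambda> unfolding abs_mult by (intro add_mono mult_mono) auto
  also have "\<dots> = \<epsilon> * (1 + \<Lambda> * c)" by (simp add: algebra_simps)
  also have "1 + \<Lambda> * c = (\<Sum>i<Suc s. \<Lambda> ^ i)"
    unfolding c_def by (subst sum.lessThan_Suc_shift) (simp add: sum_distrib_left)
  finally show ?case using Suc.hyps(2) by simp
qed

text \<open>On the box \<open>p\<close> is within \<open>\<delta>\<close> of \<open>a * q\<close> in
  total, and since both laws have mass between \<open>1 - l * t\<close> and \<open>1\<close> there,
  replacing \<open>a\<close> by \<open>1\<close> costs at most \<open>\<delta> + l * t\<close>. The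
  complement of the box adds \<open>2 * l * t\<close>.\<close>

lemma dist_TV_le_of_recurrence:
  fixes p q :: "(nat \<Rightarrow> nat) pmf"
  assumes q: "\<And>k m. m \<in> {1..l} \<Longrightarrow>
                real (Suc (k m)) * pmf q (k(m := Suc (k m))) = lam m * pmf q k"
    and p: "\<And>k m. m \<in> {1..l} \<Longrightarrow>
              \<bar>real (Suc (k m)) * pmf p (k(m := Suc (k m))) - lam m * pmf p k\<bar> \<le> \<epsilon>"
    and lam: "\<And>m. m \<in> {1..l} \<Longrightarrow> 0 \<le> lam m \<and> lam m \<le> \<Lambda>" and "0 \<le> \<Lambda>"
    and q0: "pmf q (\<lambda>_. 0) > 0"
    and supp: "set_pmf p \<subseteq> nat_vectors l" "set_pmf q \<subseteq> nat_vectors l"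
    and tail_p: "\<And>m. m \<in> {1..l} \<Longrightarrow> measure_pmf.prob p {k. N < k m} \<le> t"
    and tail_q: "\<And>m. m \<in> {1..l} \<Longrightarrow> measure_pmf.prob q {k. N < k m} \<le> t"
    and "0 \<le> \<epsilon>"
  shows "dist_TV l p q \<le> 2 * (real (N + 1) ^ l * (\<epsilon> * (\<Sum>i<l * N. \<Lambda> ^ i))) + 3 * (real l * t)"
proof -
  define a where "a = pmf p (\<lambda>_. 0) / pmf q (\<lambda>_. 0)"
  define \<delta> where "\<delta> = real (N + 1) ^ l * (\<epsilon> * (\<Sum>i<l * N. \<Lambda> ^ i))"
  define P where "P = (\<Sum>k\<in>box l N. pmf p k)"
  define Q where "Q = (\<Sum>k\<in>box l N. pmf q k)"
  have zero: "pmf p (\<lambda>_. 0) = a * pmf q (\<lambda>_. 0)" using q0 by (simp add: a_def)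
  have "(\<Sum>k\<in>box l N. \<bar>pmf p k - a * pmf q k\<bar>) \<le>
        real (card (box l N)) * (\<epsilon> * (\<Sum>i<l * N. \<Lambda> ^ i))"
  proof (rule sum_bounded_above)
    fix k assume k: "k \<in> box l N"
    hence "k \<in> nat_vectors l" by (auto simp: nat_vectors_def box_def PiE_dflt_def)
    from near_multiple_of_recurrence_solution[where p = "pmf p" and q = "pmf q", OF q p lam zero this]
    have "\<bar>pmf p k - a * pmf q k\<bar> \<le> \<epsilon> * (\<Sum>i<(\<Sum>m\<in>{1..l}. k m). \<Lambda> ^ i)" .
    also have "\<dots> \<le> \<epsilon> * (\<Sum>i<l * N. \<Lambda> ^ i)"
      using sum_le_on_box[OF k] \<open>0 \<le> \<epsilon>\<close> \<open>0 \<le> \<Lambda>\<close>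
      by (intro mult_left_mono sum_mono2) auto
    finally show "\<bar>pmf p k - a * pmf q k\<bar> \<le> \<epsilon> * (\<Sum>i<l * N. \<Lambda> ^ i)" .
  qed
  hence \<delta>: "(\<Sum>k\<in>box l N. \<bar>pmf p k - a * pmf q k\<bar>) \<le> \<delta>"
    by (simp add: \<delta>_def card_box)
  have "\<bar>P - a * Q\<bar> \<le> (\<Sum>k\<in>box l N. \<bar>pmf p k - a * pmf q k\<bar>)"
    unfolding P_def Q_def sum_distrib_left sum_subtractf [symmetric] by (rule sum_abs)
  with \<delta> have PaQ: "\<bar>P - a * Q\<bar> \<le> \<delta>" by linarith
  have P: "1 - real l * t \<le> P" "P \<le> 1" and Q: "1 - real l * t \<le> Q" "Q \<le> 1"
    unfolding P_def Q_def using prob_box[OF supp(1) tail_p] prob_box[OF supp(2) tail_q] by auto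
  have "Q \<ge> 0" by (simp add: Q_def sum_nonneg)
  \<comment> \<open>This product is exactly the sum of \<open>\<bar>a - 1\<bar> * pmf q k\<close>
    over the box. It is small because \<open>a * Q\<close> is within \<open>\<delta>\<close> of
    \<open>P\<close>, and \<open>P\<close> is within \<open>l * t\<close> of
    \<open>Q\<close>.\<close>
  have "\<bar>a - 1\<bar> * Q = \<bar>(a - 1) * Q\<bar>"
    using \<open>Q \<ge> 0\<close> by (simp add: abs_mult)
  also have "\<dots> = \<bar>a * Q - Q\<bar>"
    by (simp add: algebra_simps)
  also have "\<dots> \<le> \<delta> + real l * t" using PaQ P Q by linarith
  finally have aQ: "\<bar>a - 1\<bar> * Q \<le> \<delta> + real l * t" .
  have "(\<Sum>k\<in>box l N. \<bar>pmf p k - pmf q k\<bar>) \<le>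
        (\<Sum>k\<in>box l N. \<bar>pmf p k - a * pmf q k\<bar> + \<bar>a - 1\<bar> * pmf q k)"
  proof (rule sum_mono)
    fix k
    have "pmf p k - pmf q k = (pmf p k - a * pmf q k) + (a - 1) * pmf q k"
      by (simp add: algebra_simps)
    thus "\<bar>pmf p k - pmf q k\<bar> \<le> \<bar>pmf p k - a * pmf q k\<bar> + \<bar>a - 1\<bar> * pmf q k"
      by (metis abs_mult abs_triangle_ineq abs_of_nonneg pmf_nonneg)
  qed
  also have "\<dots> \<le> \<delta> + (\<delta> + real l * t)"
    using \<delta> aQ by (simp add: sum.distrib Q_def sum_distrib_left)
  finally have "(\<Sum>k\<in>box l N. \<bar>pmf p k - pmf q k\<bar>) \<le> 2 * \<delta> + real l * t" by simp
  moreover have "measure_pmf.prob p (nat_vectors l - box l N) \<le> real l * t"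
    by (rule prob_nat_vectors_minus_box[OF tail_p])
  moreover have "measure_pmf.prob q (nat_vectors l - box l N) \<le> real l * t"
    by (rule prob_nat_vectors_minus_box[OF tail_q])
  ultimately show ?thesis
    using dist_TV_le_box[of l p q N] unfolding \<delta>_def by linarith
qed

section \<open>Edge counts of the random matching\<close>

lemma vertex_degree_le_max_degree:
  assumes "simple_graph H"
  shows "vertex_degree H v \<le> max_degree H"
proof (cases "v \<in> verts H")
  case True
  have "bdd_above (vertex_degree H ` verts H)"
    using assms by (intro bdd_above_finite) (simp add: simple_graph_def)
  with True show ?thesis unfolding max_degree_def by (rule cSUP_upper)
next
  case False
  hence "{e \<in> edges H. v \<in> e} = {}" using assms by (auto simp: simple_graph_def)
  thus ?thesis unfolding vertex_degree_def by (metis card.empty le0)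
qed

text \<open>Both sides count the pairs \<open>(e, M)\<close> with \<open>e \<in> M\<close>.\<close>

lemma sum_card_containing:
  assumes "finite A" "finite E"
  shows "(\<Sum>e\<in>E. card {M \<in> A. e \<in> M}) = (\<Sum>M\<in>A. card (M \<inter> E))"
proof -
  have "(\<Sum>e\<in>E. card {M \<in> A. e \<in> M}) = (\<Sum>e\<in>E. \<Sum>M\<in>A. if e \<in> M then 1 else 0)"
    using assms by (simp flip: sum.inter_filter)
  also have "\<dots> = (\<Sum>M\<in>A. \<Sum>e\<in>E. if e \<in> M then 1 else 0)"
    by (rule sum.swap)
  also have "\<dots> = (\<Sum>M\<in>A. card {e \<in> E. e \<in> M})"
    using assms by (simp flip: sum.inter_filter)
  also have "\<dots> = (\<Sum>M\<in>A. card (M \<inter> E))"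
    by (intro sum.cong arg_cong[of _ _ card]) auto
  finally show ?thesis .
qed

locale sparse_subgraphs = equipartition I V n
  for I :: "'i set" and V :: "'i \<Rightarrow> 'a set" and n :: nat +
  fixes D :: "nat \<Rightarrow> 'a ugraph" and l C :: nat
  assumes subgraph: "\<And>m. m \<in> {1..l} \<Longrightarrow> subgraph_of (D m) (complete_multipartite I V)"
    and disjoint_edges: "disjoint_family_on (\<lambda>m. edges (D m)) {1..l}"
    and max_degree_le: "\<And>m. m \<in> {1..l} \<Longrightarrow> max_degree (D m) \<le> C"
begin

text \<open>A good switch must leave all the graphs undisturbed at once, so badness is taken with
  respect to their union.\<close>

definition all_edges :: "'a set set" where
  "all_edges = (\<Union>m\<in>{1..l}. edges (D m))"

sublocale sparse_edge_set I V n all_edges "l * C"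
proof unfold_locales
  show "all_edges \<subseteq> edges (complete_multipartite I V)"
    using subgraph unfolding all_edges_def subgraph_of_def by blast
  fix v
  have "{e \<in> all_edges. v \<in> e} = (\<Union>m\<in>{1..l}. {e \<in> edges (D m). v \<in> e})"
    by (auto simp: all_edges_def)
  hence "card {e \<in> all_edges. v \<in> e} \<le> (\<Sum>m\<in>{1..l}. vertex_degree (D m) v)"
    unfolding vertex_degree_def by (simp add: card_UN_le)
  also have "\<dots> \<le> (\<Sum>m\<in>{1..l}. C)"
  proof (rule sum_mono)
    fix m assume m: "m \<in> {1..l}"
    show "vertex_degree (D m) v \<le> C"
      using subgraph[OF m] max_degree_le[OF m] vertex_degree_le_max_degree[of "D m" v]
      by (simp add: subgraph_of_def)
  qed
  finally show "card {e \<in> all_edges. v \<in> e} \<le> l * C" by simp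
qed

lemma edges_subset: "m \<in> {1..l} \<Longrightarrow> edges (D m) \<subseteq> all_edges"
  by (auto simp: all_edges_def)

lemma finite_edges: "m \<in> {1..l} \<Longrightarrow> finite (edges (D m))"
  using edges_subset finite_F finite_subset by blast

text \<open>A bound on all rates that does not involve \<open>n\<close>: each graph has at most
  \<open>mean_bound * s\<close> edges, and each edge has probability at most
  \<open>1 / s\<close>.\<close>

definition mean_bound :: real where
  "mean_bound = card I * (l * C)"

text \<open>The mean of the count for \<open>D m\<close>, by \<open>card_containing_real\<close>.
  With \<open>s = (card I - 1) * n\<close> it is the Poisson rate of the theorem.\<close>

definition rate :: "nat \<Rightarrow> real" where
  "rate m = card (edges (D m)) * (n / (real s * real s))"

lemma card_edges_le: "m \<in> {1..l} \<Longrightarrow> card (edges (D m)) \<le> mean_bound * s"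
proof -
  assume m: "m \<in> {1..l}"
  have "card (edges (D m)) \<le> card I * s * (l * C)"
    using card_mono[OF finite_F edges_subset[OF m]] card_F by simp
  from of_nat_mono[OF this, where 'a = real] show ?thesis
    by (simp add: mean_bound_def algebra_simps)
qed

lemma rate_bounds: "m \<in> {1..l} \<Longrightarrow> 0 \<le> rate m \<and> rate m \<le> mean_bound"
proof -
  assume m: "m \<in> {1..l}"
  have "rate m \<le> mean_bound * s * (s / (real s * real s))"
    unfolding rate_def using card_edges_le[OF m] n_le_s
    by (intro mult_mono divide_right_mono) auto
  also have "\<dots> = mean_bound" using s_pos by simp
  finally show ?thesis by (simp add: rate_def)
qed

definition count_pmf :: "(nat \<Rightarrow> nat) pmf" where
  "count_pmf = map_pmf (matching_counts l D) (pmf_of_set \<M>)"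

lemma card_\<M>_pos: "card \<M> > 0"
  using finite_\<M> \<M>_nonempty by (simp add: card_gt_0_iff)

lemma prob_count_pmf:
  "measure_pmf.prob count_pmf {k. Q k} = card {M \<in> \<M>. Q (matching_counts l D M)} / card \<M>"
proof -
  have "\<M> \<inter> matching_counts l D -` {k. Q k} = {M \<in> \<M>. Q (matching_counts l D M)}" by auto
  thus ?thesis
    by (simp add: count_pmf_def measure_pmf_of_set finite_\<M> \<M>_nonempty)
qed

lemma pmf_count_pmf: "pmf count_pmf k = card {M \<in> \<M>. matching_counts l D M = k} / card \<M>"
  using prob_count_pmf[of "\<lambda>k'. k' = k"] by (simp add: measure_pmf_single)

lemma set_count_pmf: "set_pmf count_pmf \<subseteq> nat_vectors l"
  by (auto simp: count_pmf_def matching_counts_def nat_vectors_def PiE_dflt_def)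

text \<open>Markov's inequality in counting form; double counting of edges and matchings identifies
  the mean as \<open>rate m\<close>.\<close>

lemma tail_count_pmf:
  assumes m: "m \<in> {1..l}"
  shows "measure_pmf.prob count_pmf {k. N < k m} \<le> mean_bound / (N + 1)"
proof -
  define S where "S = {M \<in> \<M>. N < matching_counts l D M m}"
  have S: "finite S" "S \<subseteq> \<M>" using finite_\<M> by (auto simp: S_def)
  have "card S * (N + 1) = (\<Sum>M\<in>S. N + 1)" by simp
  also have "\<dots> \<le> (\<Sum>M\<in>S. card (M \<inter> edges (D m)))"
    using m by (intro sum_mono) (auto simp: S_def matching_counts_def)
  also have "\<dots> \<le> (\<Sum>M\<in>\<M>. card (M \<inter> edges (D m)))"
    using S finite_\<M> by (intro sum_mono2) auto
  also have "\<dots> = (\<Sum>e\<in>edges (D m). card {M \<in> \<M>. e \<in> M})"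
    using finite_\<M> finite_edges[OF m] by (simp add: sum_card_containing)
  finally have "real (card S * (N + 1)) \<le> (\<Sum>e\<in>edges (D m). real (card {M \<in> \<M>. e \<in> M}))"
    by (simp flip: of_nat_sum del: of_nat_mult)
  also have "\<dots> = (\<Sum>e\<in>edges (D m). n / (real s * real s) * card \<M>)"
    using edges_subset[OF m] F_edges by (intro sum.cong card_containing_real refl) auto
  also have "\<dots> = rate m * card \<M>" by (simp add: rate_def)
  also have "\<dots> \<le> mean_bound * card \<M>"
    using rate_bounds[OF m] by (intro mult_right_mono) auto
  finally have "card S / card \<M> \<le> mean_bound / (N + 1)"
    using card_\<M>_pos by (simp add: field_simps)
  thus ?thesis
    using prob_count_pmf[of "\<lambda>k. N < k m"] by (simp add: S_def)
qed

text \<open>Within \<open>all_edges\<close> the switch adds exactly \<open>{u, v}\<close>, which was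
  not in \<open>M\<close>; by edge-disjointness this edge belongs to no graph of the family but
  \<open>D m\<close>.\<close>

lemma matching_counts_switch:
  assumes ij: "i \<in> I" "j \<in> I" "i \<noteq> j" and uv: "u \<in> V i" "v \<in> V j"
    and m: "m \<in> {1..l}" "{u, v} \<in> edges (D m)"
    and good: "(M, u', v') \<in> triples i j" "(M, u', v') \<notin> bad i j u v"
  shows "matching_counts l D (switch u v u' v' M) =
         (matching_counts l D M)(m := Suc (matching_counts l D M m))"
proof
  fix m'
  have F: "{u, v} \<in> all_edges" using m edges_subset by blast
  have M: "finite M" using good(1) finite_matching by (auto simp: triples_def)
  show "matching_counts l D (switch u v u' v' M) m' =
        ((matching_counts l D M)(m := Suc (matching_counts l D M m))) m'"
  proof (cases "m' \<in> {1..l}")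
    case True
    note * = switch_Int[OF ij uv F good edges_subset[OF True]]
    show ?thesis
    proof (cases "m' = m")
      case True
      with m * have "switch u v u' v' M \<inter> edges (D m') = insert {u, v} (M \<inter> edges (D m'))"
        by auto
      with True m * M show ?thesis by (simp add: matching_counts_def)
    next
      case False
      with disjoint_edges m \<open>m' \<in> {1..l}\<close> have "{u, v} \<notin> edges (D m')"
        unfolding disjoint_family_on_def by blast
      with False * \<open>m' \<in> {1..l}\<close> show ?thesis by (simp add: matching_counts_def)
    qed
  qed (use m in \<open>auto simp: matching_counts_def\<close>)
qed

text \<open>For each edge \<open>e\<close> of \<open>D m\<close>, switching compares the matchings
  with counts \<open>k'\<close> that contain \<open>e\<close> with \<open>n / s^2\<close> times
  those with counts \<open>k\<close>, up to \<open>bad_bound * card \<M> / s^2\<close>. Summing over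
  at most \<open>mean_bound * s\<close> edges leaves an error of order \<open>1 / s\<close> after
  division by \<open>card \<M>\<close>.\<close>

lemma count_recurrence_error:
  assumes m: "m \<in> {1..l}"
  shows "\<bar>real (Suc (k m)) * pmf count_pmf (k(m := Suc (k m))) - rate m * pmf count_pmf k\<bar>
           \<le> mean_bound * bad_bound / n"
proof -
  define k' where "k' = k(m := Suc (k m))"
  define a where "a = (\<lambda>e. card {M \<in> \<M>. e \<in> M \<and> matching_counts l D M = k'})"
  define b where "b = card {M \<in> \<M>. matching_counts l D M = k}"
  let ?E = "edges (D m)"
  have count_m: "matching_counts l D M m = card (M \<inter> ?E)" for M
    using m by (simp add: matching_counts_def)
  \<comment> \<open>On these matchings the \<open>m\<close>-th count is
    \<open>k' m = Suc (k m)\<close>; counting pairs of such a matching and one of its edges in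
    \<open>D m\<close> gives the sum over edges.\<close>
  have "Suc (k m) * card {M \<in> \<M>. matching_counts l D M = k'} =
        (\<Sum>M\<in>{M \<in> \<M>. matching_counts l D M = k'}. matching_counts l D M m)"
    by (simp add: k'_def)
  also have "\<dots> = (\<Sum>M\<in>{M \<in> \<M>. matching_counts l D M = k'}. card (M \<inter> ?E))"
    by (simp only: count_m)
  also have "\<dots> = (\<Sum>e\<in>?E. a e)"
    using finite_\<M> finite_edges[OF m] unfolding a_def
    by (subst sum_card_containing [symmetric]) (auto intro!: sum.cong arg_cong[of _ _ card])
  finally have sum_a: "Suc (k m) * card {M \<in> \<M>. matching_counts l D M = k'} = (\<Sum>e\<in>?E. a e)" .
  have "\<bar>real (s * s) * a e - real n * b\<bar> \<le> bad_bound * card \<M>" if e: "e \<in> ?E" for e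
  proof -
    have "e \<in> edges (complete_multipartite I V)" using e edges_subset[OF m] F_edges by blast
    then obtain i j u v where ij: "i \<in> I" "j \<in> I" "i \<noteq> j" and uv: "u \<in> V i" "v \<in> V j"
      and euv: "e = {u, v}"
      by (auto simp: complete_multipartite_def)
    show ?thesis unfolding a_def b_def euv
    proof (rule switch_count_error[OF ij uv])
      fix M u' v' assume "(M, u', v') \<in> triples i j" "(M, u', v') \<notin> bad i j u v"
      \<comment> \<open>Raising coordinate \<open>m\<close> by one is injective, so counts
        \<open>k'\<close> after the switch mean counts \<open>k\<close> before it.\<close>
      from matching_counts_switch[OF ij uv m e[unfolded euv] this]
      show "matching_counts l D (switch u v u' v' M) = k' \<longleftrightarrow> matching_counts l D M = k"
        by (auto simp: k'_def fun_eq_iff split: if_splits)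
    qed
  qed
  hence "\<bar>\<Sum>e\<in>?E. real (s * s) * a e - real n * b\<bar> \<le> card ?E * (bad_bound * card \<M>)"
    by (intro order_trans[OF sum_abs] sum_bounded_above)
  also have "(\<Sum>e\<in>?E. real (s * s) * a e - real n * b) =
      real (s * s) * real (\<Sum>e\<in>?E. a e) - card ?E * (real n * b)"
    by (simp add: sum_subtractf sum_distrib_left)
  also have "\<dots> = real s * real s * card \<M> *
      (real (Suc (k m)) * pmf count_pmf k' - rate m * pmf count_pmf k)"
    using s_pos card_\<M>_pos unfolding sum_a [symmetric] pmf_count_pmf rate_def b_def
    by (simp add: field_simps)
  finally have "real s * real s * card \<M> *
      \<bar>real (Suc (k m)) * pmf count_pmf k' - rate m * pmf count_pmf k\<bar>
        \<le> card ?E * (bad_bound * card \<M>)"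
    by (simp add: abs_mult del: of_nat_Suc)
  also have "\<dots> \<le> mean_bound * s * (bad_bound * card \<M>)"
    using card_edges_le[OF m] by (intro mult_right_mono) (auto simp: bad_bound_def)
  finally have "\<bar>real (Suc (k m)) * pmf count_pmf k' - rate m * pmf count_pmf k\<bar>
      \<le> mean_bound * s * (bad_bound * card \<M>) / (real s * real s * card \<M>)"
    using s_pos card_\<M>_pos by (simp add: pos_le_divide_eq mult.commute del: of_nat_Suc)
  also have "\<dots> = mean_bound * bad_bound / s"
    using s_pos card_\<M>_pos by simp
  also have "\<dots> \<le> mean_bound * bad_bound / n"
    using n_le_s n_pos by (intro divide_left_mono) (auto simp: mean_bound_def bad_bound_def)
  finally show ?thesis by (simp add: k'_def)
qed

section \<open>Quantitative bound and passage to the limit\<close>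

text \<open>The box size \<open>N\<close> stays free, so that it can be fixed before
  \<open>n\<close> grows: the first term then tends to \<open>0\<close> with \<open>n\<close>, and
  the second depends on \<open>N\<close> only through \<open>1 / (N + 1)\<close>.\<close>

lemma dist_TV_count_pmf_le:
  "dist_TV l count_pmf (Pi_pmf {1..l} 0 (\<lambda>m. poisson0_pmf (rate m))) \<le>
     2 * (real (N + 1) ^ l * (mean_bound * bad_bound / n * (\<Sum>i<l * N. mean_bound ^ i))) +
     3 * (real l * (mean_bound / (N + 1)))"
proof (rule dist_TV_le_of_recurrence[where lam = rate])
  show "set_pmf (Pi_pmf {1..l} 0 (\<lambda>m. poisson0_pmf (rate m))) \<subseteq> nat_vectors l"
    using set_Pi_pmf_subset'[of "{1..l}" 0 "\<lambda>m. poisson0_pmf (rate m)"]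
    by (auto simp: nat_vectors_def PiE_dflt_def)
  fix m assume m: "m \<in> {1..l}"
  have "measure_pmf.prob (Pi_pmf {1..l} 0 (\<lambda>m. poisson0_pmf (rate m))) {k. N < k m} \<le> rate m / (N + 1)"
    using rate_bounds[OF m] m by (intro Pi_poisson0_tail) auto
  also have "\<dots> \<le> mean_bound / (N + 1)"
    using rate_bounds[OF m] by (intro divide_right_mono) auto
  finally show "measure_pmf.prob (Pi_pmf {1..l} 0 (\<lambda>m. poisson0_pmf (rate m))) {k. N < k m}
      \<le> mean_bound / (N + 1)" .
next
  fix k :: "nat \<Rightarrow> nat" and m assume m: "m \<in> {1..l}"
  show "real (Suc (k m)) * pmf (Pi_pmf {1..l} 0 (\<lambda>m. poisson0_pmf (rate m))) (k(m := Suc (k m))) =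
        rate m * pmf (Pi_pmf {1..l} 0 (\<lambda>m. poisson0_pmf (rate m))) k"
    using m rate_bounds[OF m] by (intro pmf_Pi_poisson0_Suc) auto
  show "\<bar>real (Suc (k m)) * pmf count_pmf (k(m := Suc (k m))) - rate m * pmf count_pmf k\<bar>
      \<le> mean_bound * bad_bound / n"
    by (rule count_recurrence_error[OF m])
next
  show "0 < pmf (Pi_pmf {1..l} 0 (\<lambda>m. poisson0_pmf (rate m))) (\<lambda>_. 0)"
    using rate_bounds by (intro pmf_Pi_poisson0_zero_pos) auto
qed (use rate_bounds set_count_pmf tail_count_pmf in \<open>auto simp: mean_bound_def bad_bound_def\<close>)

end

theorem theorem1p3:
  fixes r l C :: nat
    and V :: "nat \<Rightarrow> nat \<Rightarrow> 'a set"
    and D :: "nat \<Rightarrow> nat \<Rightarrow> 'a ugraph"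
  assumes "r \<ge> 2" and "l \<ge> 1"
    and "\<And>n. n \<ge> 1 \<Longrightarrow> disjoint_family_on (V n) {1..r}"
    and "\<And>n i. n \<ge> 1 \<Longrightarrow> i \<in> {1..r} \<Longrightarrow> finite (V n i) \<and> card (V n i) = (r - 1) * n"
    and "\<And>n m. n \<ge> 1 \<Longrightarrow> m \<in> {1..l} \<Longrightarrow>
           subgraph_of (D n m) (complete_multipartite {1..r} (V n))"
    and "\<And>n. n \<ge> 1 \<Longrightarrow> disjoint_family_on (\<lambda>m. edges (D n m)) {1..l}"
    and "\<And>n m. n \<ge> 1 \<Longrightarrow> m \<in> {1..l} \<Longrightarrow> max_degree (D n m) \<le> C"
  shows "(\<lambda>n. dist_TV l
            (map_pmf (matching_counts l (D n))
               (pmf_of_set (balanced_perfect_matchings {1..r} (V n))))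
            (Pi_pmf {1..l} 0 (\<lambda>m. poisson0_pmf
               (real (card (edges (D n m))) / (real ((r - 1)\<^sup>2) * real n)))))
         \<longlonglongrightarrow> 0"
    (is "?d \<longlonglongrightarrow> 0")
proof (rule LIMSEQ_I)
  fix e :: real assume e: "e > 0"
  define \<Lambda> where "\<Lambda> = real (r * (l * C))"
  define K where "K = \<Lambda> * (real (r * (l * C)) + 4 * real (l * C) + 2)"
  \<comment> \<open>\<open>N\<close> makes the tail term smaller than \<open>e / 2\<close>. It does
    not depend on \<open>n\<close>, so \<open>A\<close> is a constant, and \<open>n\<^sub>0\<close>
    makes \<open>A / n\<close> smaller than \<open>e / 2\<close> as well.\<close>
  define N where "N = nat \<lceil>6 * (real l * \<Lambda>) / e\<rceil>"
  define A where "A = 2 * (real (N + 1) ^ l * (K * (\<Sum>i<l * N. \<Lambda> ^ i)))"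
  define n\<^sub>0 where "n\<^sub>0 = Suc (nat \<lceil>2 * A / e\<rceil>)"
  have bound: "?d n \<le> A / n + 3 * (real l * (\<Lambda> / (N + 1)))" if n: "n \<ge> 1" for n
  proof -
    interpret sparse_subgraphs "{1..r}" "V n" n "D n" l C
      using assms n by unfold_locales auto
    have card_I: "card {1..r} = r" by simp
    \<comment> \<open>With \<open>t = r - 1\<close> this turns \<open>n / s^2\<close> into
      \<open>1 / ((r - 1)^2 * n)\<close>, the form of the rate in the theorem.\<close>
    have cancel: "c * (real n / (real (t * n) * real (t * n))) = c / (real (t\<^sup>2) * real n)"
      if "t > 0" for c :: real and t
      using that n by (simp add: power2_eq_square)
    have rate_eq: "rate = (\<lambda>m. real (card (edges (D n m))) / (real ((r - 1)\<^sup>2) * real n))"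
      unfolding rate_def [abs_def] s_def card_I
      by (intro ext cancel) (use assms(1) in simp)
    have bounds: "mean_bound = \<Lambda>" "\<Lambda> * bad_bound = K"
      unfolding K_def \<Lambda>_def mean_bound_def bad_bound_def card_I by simp_all
    have "A / n = 2 * (real (N + 1) ^ l * (K / n * (\<Sum>i<l * N. \<Lambda> ^ i)))"
      by (simp add: A_def)
    thus ?thesis
      using dist_TV_count_pmf_le[of N] unfolding bounds rate_eq count_pmf_def by (simp only: bounds)
  qed
  have "6 * (real l * \<Lambda>) / e \<le> N" unfolding N_def by linarith
  hence "6 * (real l * \<Lambda>) / e < real N + 1" by linarith
  hence tail: "3 * (real l * (\<Lambda> / (N + 1))) < e / 2"
    using e by (simp add: field_simps)
  have "norm (?d n - 0) < e" if n: "n \<ge> n\<^sub>0" for n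
  proof -
    have "n \<ge> 1" using n by (simp add: n\<^sub>0_def)
    have "2 * A / e < n" using n unfolding n\<^sub>0_def by linarith
    hence "A / n < e / 2" using e \<open>n \<ge> 1\<close> by (simp add: field_simps)
    with bound[OF \<open>n \<ge> 1\<close>] tail have "?d n < e" by linarith
    moreover have "?d n \<ge> 0" unfolding dist_TV_def by (rule infsum_nonneg) simp
    ultimately show ?thesis by simp
  qed
  thus "\<exists>n\<^sub>0. \<forall>n\<ge>n\<^sub>0. norm (?d n - 0) < e" by blast
qed

end
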